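(* Assume each $f_i:\mathbb{R}^d\to\mathbb{R}$ ($i=1,\dots,n$) is $\mu$-strongly convex and $L$-smooth, let $f=\frac1n\sum_{i=1}^n f_i$, let $R:\mathbb{R}^d\to\mathbb{R}\cup\{+\infty\}$ be a closed convex regularizer, and let $x^\star$ be a minimizer of $f+R$. Consider the DIANA algorithm (described in the context) with an $\omega$-quantization operator $Q$, and assume that the stochastic gradients satisfy $\mathbb{E}[\|g_i^k-\nabla f_i(x^k)\|_2^2]\le\sigma_i^2$ for all $k\ge 0$ and $i=1,\dots,n$, with finite constants $\sigma_i$; set $\sigma^2=\frac1n\sum_{i=1}^n\sigma_i^2$. Let the step sizes $\alpha,\gamma>0$ and the constant $c$ satisfy $$\alpha\le\frac{1}{\omega+1},\qquad c\ge\frac{4\omega}{\alpha n},\qquad \gamma\le\frac{2}{(\mu+L)\left(1+\frac{2\omega}{n}+c\alpha\right)},\qquad \gamma\le\frac{\alpha}{2\mu}.$$ Define $$\Psi^k=\|x^k-x^\star\|_2^2+\frac{c\gamma^2}{n}\sum_{i=1}^n\|h_i^k-\nabla f_i(x^\star)\|_2^2 .$$ Then for all $k\ge 0$, $$\mathbb{E}[\Psi^k]\le(1-\gamma\mu)^k\,\Psi^0+\frac{2}{\mu(\mu+L)}\sigma^2 .$$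
   Context: Differentiable $f$ is $\mu$-strongly convex ($\mu>0$) if $f(y)\ge f(x)+\langle\nabla f(x),y-x\rangle+\frac{\mu}{2}\|x-y\|_2^2$ for all $x,y$; it is $L$-smooth ($L>0$) if $f(y)\le f(x)+\langle\nabla f(x),y-x\rangle+\frac L2\|x-y\|_2^2$ for all $x,y$. The prox operator is $\mathrm{prox}_{\gamma R}(x)=\arg\min_y\{\gamma R(y)+\frac12\|y-x\|_2^2\}$. An $\omega$-quantization operator ($\omega\ge0$) is a random map $Q:\mathbb{R}^d\to\mathbb{R}^d$ such that for all $x\in\mathbb{R}^d$: $\mathbb{E}_Q[Q(x)]=x$ and $\mathbb{E}_Q[\|Q(x)\|_2^2]\le(\omega+1)\|x\|_2^2$. DIANA algorithm. Input: $\alpha,\gamma>0$, deterministic vectors $x^0,h_1^0,\dots,h_n^0\in\mathbb{R}^d$. For $k=0,1,2,\dots$: for each worker $i=1,\dots,n$, sample a stochastic gradient $g_i^k$ with conditional mean $\nabla f_i(x^k)$ given the history up to iteration $k$ (i.e. given $x^k,h_1^k,\dots,h_n^k$ and all earlier randomness); set $\Delta_i^k=g_i^k-h_i^k$, $\hat\Delta_i^k=Q(\Delta_i^k)$, $h_i^{k+1}=h_i^k+\alpha\hat\Delta_i^k$, $\hat g_i^k=h_i^k+\hat\Delta_i^k$. Then set $\hat g^k=\frac1n\sum_{i=1}^n\hat g_i^k$ and $x^{k+1}=\mathrm{prox}_{\gamma R}(x^k-\gamma\hat g^k)$. Given the history, the stochastic gradients of different workers are independent, and each application of $Q$ uses fresh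 randomness, independent across workers and of everything else. *)

theory Defs
  imports "HOL-Probability.Probability"
begin

definition grad :: "('a::euclidean_space \<Rightarrow> real) \<Rightarrow> 'a \<Rightarrow> 'a" where
  "grad f x = (THE D. GDERIV f x :> D)"

lemma grad_eq:
  assumes "GDERIV f x :> D"
  shows "grad f x = D"
  unfolding grad_def
proof (rule the_equality)
  show "GDERIV f x :> D" by (rule assms)
next
  fix D' assume "GDERIV f x :> D'"
  from has_derivative_unique[OF this[unfolded gderiv_def] assms[unfolded gderiv_def]]
  have "h \<bullet> D' = h \<bullet> D" for h
    by (rule fun_cong)
  then show "D' = D"
    using vector_eq_ldot by blast
qed

definition strongly_convex :: "real \<Rightarrow> ('a::euclidean_space \<Rightarrow> real) \<Rightarrow> bool" where
  "strongly_convex \<mu> f \<longleftrightarrow>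
     0 < \<mu> \<and> (\<forall>x. f differentiable (at x)) \<and>
     (\<forall>x y. f y \<ge> f x + grad f x \<bullet> (y - x) + \<mu> / 2 * (norm (x - y))\<^sup>2)"

definition L_smooth :: "real \<Rightarrow> ('a::euclidean_space \<Rightarrow> real) \<Rightarrow> bool" where
  "L_smooth L f \<longleftrightarrow>
     0 < L \<and> (\<forall>x. f differentiable (at x)) \<and>
     (\<forall>x y. f y \<le> f x + grad f x \<bullet> (y - x) + L / 2 * (norm (x - y))\<^sup>2)"

text \<open>A function into \<open>\<real> \<union> {+\<infinity>}\<close> is an \<^typ>\<open>ereal\<close>-valued function that avoids \<open>-\<infinity>\<close>.
  Properness is part of the usual convention for closed convex functions: for \<open>R = +\<infinity>\<close> the proximal operator is undefined.\<close>

definition ereal_epigraph :: "('a::euclidean_space \<Rightarrow> ereal) \<Rightarrow> ('a \<times> real) set" where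
  "ereal_epigraph R = {(x, t). R x \<le> ereal t}"

definition proper_closed_convex :: "('a::euclidean_space \<Rightarrow> ereal) \<Rightarrow> bool" where
  "proper_closed_convex R \<longleftrightarrow>
     (\<forall>x. R x \<noteq> -\<infinity>) \<and> (\<exists>x. R x \<noteq> \<infinity>) \<and>
     convex (ereal_epigraph R) \<and> closed (ereal_epigraph R)"

definition prox :: "real \<Rightarrow> ('a::euclidean_space \<Rightarrow> ereal) \<Rightarrow> 'a \<Rightarrow> 'a" where
  "prox \<gamma> R x =
     arg_min (\<lambda>y. ereal \<gamma> * R y + ereal (1 / 2 * (norm (y - x))\<^sup>2)) (\<lambda>_. True)"

text \<open>A random map is a function \<open>Q u x\<close> of a random seed \<open>u\<close> with law \<open>S\<close>. Joint measurability
  makes \<open>Q u x\<close> a random variable also for random \<open>x\<close>.\<close>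

definition quantization_operator ::
    "real \<Rightarrow> 'u measure \<Rightarrow> ('u \<Rightarrow> 'a::euclidean_space \<Rightarrow> 'a) \<Rightarrow> bool" where
  "quantization_operator \<omega> S Q \<longleftrightarrow>
     0 \<le> \<omega> \<and> prob_space S \<and>
     (\<lambda>(u, x). Q u x) \<in> borel_measurable (S \<Otimes>\<^sub>M borel) \<and>
     (\<forall>x. integrable S (\<lambda>u. Q u x) \<and> (LINT u|S. Q u x) = x \<and>
          integrable S (\<lambda>u. (norm (Q u x))\<^sup>2) \<and>
          (LINT u|S. (norm (Q u x))\<^sup>2) \<le> (\<omega> + 1) * (norm x)\<^sup>2)"

text \<open>Conditional expectation of a vector is taken coordinatewise, the library's
  \<^const>\<open>real_cond_exp\<close> being real-valued.\<close>

definition has_cond_mean ::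
    "'w measure \<Rightarrow> 'w measure \<Rightarrow> ('w \<Rightarrow> 'a::euclidean_space) \<Rightarrow> ('w \<Rightarrow> 'a) \<Rightarrow> bool" where
  "has_cond_mean M F X Y \<longleftrightarrow>
     integrable M X \<and>
     (\<forall>b\<in>Basis. AE w in M. real_cond_exp M F (\<lambda>w. X w \<bullet> b) w = Y w \<bullet> b)"

definition cond_indep_vars ::
    "'w measure \<Rightarrow> 'w measure \<Rightarrow> ('i \<Rightarrow> 'w \<Rightarrow> 'a::topological_space) \<Rightarrow> 'i set \<Rightarrow> bool" where
  "cond_indep_vars M F X I \<longleftrightarrow>
     (\<forall>i\<in>I. X i \<in> borel_measurable M) \<and>
     (\<forall>J\<subseteq>I. finite J \<longrightarrow> J \<noteq> {} \<longrightarrow> (\<forall>A\<in>J \<rightarrow> sets borel. AE w in M.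
        real_cond_exp M F (indicator (\<Inter>j\<in>J. X j -` A j \<inter> space M)) w =
        (\<Prod>j\<in>J. real_cond_exp M F (indicator (X j -` A j \<inter> space M)) w)))"

text \<open>\<open>history\<close> is the information available when the stochastic gradients of iteration \<open>k\<close> are
  sampled, \<open>pre_quantization\<close> the information available when \<open>Q\<close> is applied in iteration \<open>k\<close>;
  \<open>\<xi> l i\<close> is the seed used by worker \<open>i\<close> in iteration \<open>l\<close>.\<close>

definition history ::
    "'w measure \<Rightarrow> 'u measure \<Rightarrow> nat \<Rightarrow> (nat \<Rightarrow> 'w \<Rightarrow> 'a::euclidean_space) \<Rightarrow>
     (nat \<Rightarrow> nat \<Rightarrow> 'w \<Rightarrow> 'a) \<Rightarrow> (nat \<Rightarrow> nat \<Rightarrow> 'w \<Rightarrow> 'a) \<Rightarrow>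
     (nat \<Rightarrow> nat \<Rightarrow> 'w \<Rightarrow> 'u) \<Rightarrow> nat \<Rightarrow> 'w measure" where
  "history M S n x h g \<xi> k = sigma (space M)
     (sets (vimage_algebra (space M) (x k) borel) \<union>
      (\<Union>i\<in>{1..n}. sets (vimage_algebra (space M) (h k i) borel)) \<union>
      (\<Union>l\<in>{..<k}. \<Union>i\<in>{1..n}. sets (vimage_algebra (space M) (g l i) borel) \<union>
                              sets (vimage_algebra (space M) (\<xi> l i) S)))"

definition pre_quantization ::
    "'w measure \<Rightarrow> 'u measure \<Rightarrow> nat \<Rightarrow> (nat \<Rightarrow> 'w \<Rightarrow> 'a::euclidean_space) \<Rightarrow>
     (nat \<Rightarrow> nat \<Rightarrow> 'w \<Rightarrow> 'a) \<Rightarrow> (nat \<Rightarrow> nat \<Rightarrow> 'w \<Rightarrow> 'a) \<Rightarrow>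
     (nat \<Rightarrow> nat \<Rightarrow> 'w \<Rightarrow> 'u) \<Rightarrow> nat \<Rightarrow> 'w measure" where
  "pre_quantization M S n x h g \<xi> k = sigma (space M)
     (sets (history M S n x h g \<xi> k) \<union>
      (\<Union>i\<in>{1..n}. sets (vimage_algebra (space M) (g k i) borel)))"

text \<open>In \<open>fresh_seeds\<close>, index \<open>None\<close> stands for everything that precedes the quantization step and
  \<open>Some i\<close> for the seed of worker \<open>i\<close>; all of these are mutually independent.\<close>

locale diana = prob_space M
  for M :: "'w measure" and S :: "'u measure" and Q :: "'u \<Rightarrow> 'a::euclidean_space \<Rightarrow> 'a"
    and n :: nat and f :: "nat \<Rightarrow> 'a \<Rightarrow> real" and R :: "'a \<Rightarrow> ereal"
    and \<alpha> \<gamma> :: real and x\<^sub>0 :: 'a and h\<^sub>0 :: "nat \<Rightarrow> 'a"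
    and x :: "nat \<Rightarrow> 'w \<Rightarrow> 'a" and h g :: "nat \<Rightarrow> nat \<Rightarrow> 'w \<Rightarrow> 'a"
    and \<xi> :: "nat \<Rightarrow> nat \<Rightarrow> 'w \<Rightarrow> 'u" +
  assumes x_init: "\<And>w. w \<in> space M \<Longrightarrow> x 0 w = x\<^sub>0"
    and h_init: "\<And>i w. i \<in> {1..n} \<Longrightarrow> w \<in> space M \<Longrightarrow> h 0 i w = h\<^sub>0 i"
    and h_step: "\<And>k i w. i \<in> {1..n} \<Longrightarrow> w \<in> space M \<Longrightarrow>
        h (Suc k) i w = h k i w + \<alpha> *\<^sub>R Q (\<xi> k i w) (g k i w - h k i w)"
    and x_step: "\<And>k w. w \<in> space M \<Longrightarrow>
        x (Suc k) w = prox \<gamma> R (x k w - \<gamma> *\<^sub>R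
          ((1 / real n) *\<^sub>R (\<Sum>i=1..n. h k i w + Q (\<xi> k i w) (g k i w - h k i w))))"
    and gradient_measurable: "\<And>k i. i \<in> {1..n} \<Longrightarrow> g k i \<in> borel_measurable M"
    and gradient_unbiased: "\<And>k i. i \<in> {1..n} \<Longrightarrow>
        has_cond_mean M (history M S n x h g \<xi> k) (g k i) (\<lambda>w. grad (f i) (x k w))"
    and gradient_indep: "\<And>k. cond_indep_vars M (history M S n x h g \<xi> k) (g k) {1..n}"
    and seed_measurable: "\<And>k i. i \<in> {1..n} \<Longrightarrow> \<xi> k i \<in> measurable M S"
    and seed_law: "\<And>k i. i \<in> {1..n} \<Longrightarrow> distr M S (\<xi> k i) = S"
    and fresh_seeds: "\<And>k. indep_sets
        (\<lambda>j. case j of None \<Rightarrow> sets (pre_quantization M S n x h g \<xi> k)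
                     | Some i \<Rightarrow> sets (vimage_algebra (space M) (\<xi> k i) S))
        (insert None (Some ` {1..n}))"

definition lyapunov ::
    "nat \<Rightarrow> (nat \<Rightarrow> 'a::euclidean_space \<Rightarrow> real) \<Rightarrow> real \<Rightarrow> real \<Rightarrow> 'a \<Rightarrow>
     'a \<Rightarrow> (nat \<Rightarrow> 'a) \<Rightarrow> real" where
  "lyapunov n f c \<gamma> xs y hs =
     (norm (y - xs))\<^sup>2 + c * \<gamma>\<^sup>2 / real n * (\<Sum>i=1..n. (norm (hs i - grad (f i) xs))\<^sup>2)"

end

theory Submission
  imports Defs
begin

text \<open>The proof follows one iteration in expectation and shows that the Lyapunov function contracts by
\<open>1 - \<gamma> * \<mu>\<close> up to an additive noise term. Summing the resulting geometric series gives the bound.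

The minimizer is a fixed point of the proximal step taken along the exact gradient \<open>h\<^sup>*\<close>, the mean of
\<open>h\<^sub>i\<^sup>* = grad (f i) xstar\<close>, so \<open>prox_step_towards_minimizer\<close> gives
\<open>\<parallel>x' - xstar\<parallel> \<le> \<parallel>(x - xstar) - \<gamma> * (g' - h\<^sup>*)\<parallel>\<close> for the quantized gradient estimate \<open>g'\<close>. The
vector on the right splits into three parts: the exact gradient step
\<open>V = (x - xstar) - \<gamma> * (grad f x - h\<^sup>*)\<close>, a multiple of the stochastic gradient noise, and a multiple of
the quantization error. Given what was known before each of them was drawn, the last two have mean
zero, so the three parts are orthogonal in \<open>L\<^sup>2\<close> and their second moments add up (\<open>err_x_step\<close>).
Since the quantization errors of the workers are orthogonal to each other as well,
they contribute only \<open>\<gamma>\<^sup>2 * \<omega> / n\<^sup>2\<close> times the sum of \<open>E \<parallel>g\<^sub>i - h\<^sub>i\<parallel>\<^sup>2\<close>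
(\<open>independent_quantization_errors\<close>).

The exact step contracts by the co-coercivity of gradients of strongly convex smooth functions
(\<open>strongly_convex_smooth_cocoercive\<close>), which also leaves a negative multiple of
\<open>\<parallel>grad (f i) x - h\<^sub>i\<^sup>*\<parallel>\<^sup>2\<close>. The memory vectors satisfy
\<open>E \<parallel>h\<^sub>i' - h\<^sub>i\<^sup>*\<parallel>\<^sup>2 \<le> (1 - \<alpha>) * E \<parallel>h\<^sub>i - h\<^sub>i\<^sup>*\<parallel>\<^sup>2 + \<alpha> * E \<parallel>g\<^sub>i - h\<^sub>i\<^sup>*\<parallel>\<^sup>2\<close> (\<open>err_h_step\<close>). In the
Lyapunov function, weighted by \<open>c\<close>, their decrease absorbs the quantization error caused by
\<open>\<parallel>h\<^sub>i - h\<^sub>i\<^sup>*\<parallel>\<^sup>2\<close>, and the negative multiple of \<open>\<parallel>grad (f i) x - h\<^sub>i\<^sup>*\<parallel>\<^sup>2\<close> absorbs all terms in the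
gradient differences. The conditions on \<open>c\<close> and \<open>\<gamma>\<close> make these two absorptions possible
(\<open>lyapunov_step\<close>).\<close>

section \<open>Gradients of strongly convex smooth functions\<close>

lemma strong_convexity_le_smoothness:
  fixes f :: "'a::euclidean_space \<Rightarrow> real"
  assumes sc: "strongly_convex \<mu> f" and sm: "L_smooth L f"
  shows "\<mu> \<le> L"
proof -
  obtain b :: 'a where b: "b \<in> Basis" by (meson nonempty_Basis ex_in_conv)
  have "\<mu> / 2 * (norm (0 - b))\<^sup>2 \<le> L / 2 * (norm (0 - b))\<^sup>2"
    using sc sm unfolding strongly_convex_def L_smooth_def by (smt (verit))
  then show ?thesis using b by simp
qed

text \<open>Subtracting \<open>\<mu> / 2 * \<parallel>z\<parallel>\<^sup>2\<close> from \<open>f\<close> leaves a convex \<open>(L - \<mu>)\<close>-smooth function, whose gradient difference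
is the vector \<open>d\<close> of the proof. Its plain co-coercivity \<open>\<parallel>d\<parallel>\<^sup>2 \<le> (L - \<mu>) * (d \<bullet> v)\<close>, rewritten
in terms of \<open>f\<close>, is the claim.\<close>

lemma strongly_convex_smooth_cocoercive:
  assumes sc: "strongly_convex \<mu> f" and sm: "L_smooth L f"
  shows "(norm (grad f x - grad f y))\<^sup>2 + \<mu> * L * (norm (x - y))\<^sup>2
    \<le> (\<mu> + L) * ((grad f x - grad f y) \<bullet> (x - y))"
proof -
  have lower: "f b \<ge> f a + grad f a \<bullet> (b - a) + \<mu> / 2 * (norm (a - b))\<^sup>2" for a b
    using sc by (simp add: strongly_convex_def)
  have upper: "f b \<le> f a + grad f a \<bullet> (b - a) + L / 2 * (norm (a - b))\<^sup>2" for a b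
    using sm by (simp add: L_smooth_def)
  define u v where "u = grad f x - grad f y" and "v = x - y"
  define d where "d = u - \<mu> *\<^sub>R v"
  \<comment> \<open>Compare the lower bound at one point with the upper bound at the other, at a trial point shifted
    by \<open>s *\<^sub>R d\<close>; the best \<open>s\<close> is \<open>1 / (L - \<mu>)\<close>, and if
    \<open>L = \<mu>\<close>, a large \<open>s\<close> forces \<open>d = 0\<close>.\<close>
  have trial: "2 * s * (norm d)\<^sup>2 - (L - \<mu>) * s\<^sup>2 * (norm d)\<^sup>2 \<le> d \<bullet> v" for s
  proof -
    define e where "e = s *\<^sub>R d"
    have "f x + grad f x \<bullet> (e - v) + \<mu> / 2 * (norm (v - e))\<^sup>2 \<le> f (y + e)"
      using lower[of x "y + e"] by (simp add: v_def algebra_simps)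
    also have "\<dots> \<le> f y + grad f y \<bullet> e + L / 2 * (norm e)\<^sup>2"
      using upper[of "y + e" y] by simp
    finally have 1: "f x + grad f x \<bullet> (e - v) + \<mu> / 2 * (norm (v - e))\<^sup>2
      \<le> f y + grad f y \<bullet> e + L / 2 * (norm e)\<^sup>2" .
    have "f y + grad f y \<bullet> (v - e) + \<mu> / 2 * (norm (v - e))\<^sup>2 \<le> f (x - e)"
      using lower[of y "x - e"] by (simp add: v_def algebra_simps norm_minus_commute)
    also have "\<dots> \<le> f x - grad f x \<bullet> e + L / 2 * (norm e)\<^sup>2"
      using upper[of "x - e" x] by simp
    finally have 2: "f y + grad f y \<bullet> (v - e) + \<mu> / 2 * (norm (v - e))\<^sup>2
      \<le> f x - grad f x \<bullet> e + L / 2 * (norm e)\<^sup>2" .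
    have "2 * (u \<bullet> e) - u \<bullet> v + \<mu> * (norm (v - e))\<^sup>2 \<le> L * (norm e)\<^sup>2"
      using 1 2 by (simp add: u_def inner_diff_left inner_diff_right)
    then show ?thesis
      unfolding e_def power2_norm_eq_inner d_def
      by (simp add: inner_diff_left inner_diff_right inner_commute algebra_simps power2_eq_square)
  qed
  have "\<mu> \<le> L" by (rule strong_convexity_le_smoothness[OF sc sm])
  have "(norm d)\<^sup>2 \<le> (L - \<mu>) * (d \<bullet> v)"
  proof (cases "\<mu> = L")
    case True
    have "d = 0"
    proof (rule ccontr)
      assume "d \<noteq> 0"
      then have pos: "(norm d)\<^sup>2 > 0" by simp
      have "2 * ((d \<bullet> v + 1) / (norm d)\<^sup>2) * (norm d)\<^sup>2 \<le> d \<bullet> v"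
        and "0 \<le> d \<bullet> v"
        using trial[of "(d \<bullet> v + 1) / (norm d)\<^sup>2"] trial[of 0] True by simp_all
      then show False using pos by simp
    qed
    then show ?thesis by simp
  next
    case False
    then have pos: "L - \<mu> > 0" using \<open>\<mu> \<le> L\<close> by simp
    have "(L - \<mu>) * (1 / (L - \<mu>))\<^sup>2 = 1 / (L - \<mu>)"
      using pos by (simp add: power2_eq_square)
    then have "(norm d)\<^sup>2 / (L - \<mu>) \<le> d \<bullet> v"
      using trial[of "1 / (L - \<mu>)"] by simp
    then show ?thesis using pos by (simp add: field_simps)
  qed
  then have "(norm u)\<^sup>2 + \<mu> * L * (norm v)\<^sup>2 \<le> (\<mu> + L) * (u \<bullet> v)"
    unfolding power2_norm_eq_inner d_def
    by (simp add: inner_diff_left inner_diff_right inner_commute algebra_simps power2_eq_square)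
  then show ?thesis by (simp add: u_def v_def)
qed

text \<open>By Cauchy-Schwarz from co-coercivity. The Lipschitz bound makes the gradients along the iterates
measurable and square-integrable.\<close>

lemma grad_lipschitz:
  assumes sc: "strongly_convex \<mu> f" and sm: "L_smooth L f"
  shows "norm (grad f x - grad f y) \<le> (\<mu> + L) * norm (x - y)"
proof -
  have pos: "0 < \<mu>" "0 < L" using sc sm by (auto simp: strongly_convex_def L_smooth_def)
  have "0 \<le> \<mu> * L * (norm (x - y))\<^sup>2" using pos by simp
  then have "(norm (grad f x - grad f y))\<^sup>2 \<le> (\<mu> + L) * ((grad f x - grad f y) \<bullet> (x - y))"
    using strongly_convex_smooth_cocoercive[OF assms, of x y] by linarith
  also have "\<dots> \<le> (\<mu> + L) * (norm (grad f x - grad f y) * norm (x - y))"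
    using pos by (intro mult_left_mono norm_cauchy_schwarz) auto
  finally have "norm (grad f x - grad f y) * norm (grad f x - grad f y)
      \<le> norm (grad f x - grad f y) * ((\<mu> + L) * norm (x - y))"
    by (simp add: power2_eq_square algebra_simps)
  then show ?thesis
    using pos by (cases "norm (grad f x - grad f y) = 0") (auto simp: mult_le_cancel_left)
qed

lemma grad_borel_measurable:
  assumes sc: "strongly_convex \<mu> f" and sm: "L_smooth L f"
  shows "grad f \<in> borel_measurable borel"
proof -
  have "(\<mu> + L)-lipschitz_on UNIV (grad f)"
    using grad_lipschitz[OF assms] sc sm
    by (intro lipschitz_onI) (auto simp: dist_norm strongly_convex_def L_smooth_def)
  then show ?thesis
    by (intro borel_measurable_continuous_onI lipschitz_on_continuous_on)
qed

section \<open>Optimality conditions and proximal steps\<close>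

text \<open>Moving from the minimizer \<open>z\<close> a fraction \<open>s\<close> of the way towards \<open>y\<close> changes \<open>R\<close> by at most \<open>s * (R y - R z)\<close>
and \<open>F\<close> by at most \<open>s * (G \<bullet> (y - z))\<close> up to order \<open>s\<^sup>2\<close>; minimality and \<open>s \<rightarrow> 0\<close> make \<open>-G\<close> a subgradient
of \<open>R\<close> at \<open>z\<close>. The conclusion speaks of real points \<open>(y, t)\<close> of the epigraph of \<open>R\<close> to avoid arithmetic with \<open>\<infinity>\<close>.\<close>

lemma first_order_optimality:
  fixes R :: "'a::euclidean_space \<Rightarrow> ereal"
  assumes R: "proper_closed_convex R"
    and minimal: "\<And>y. ereal (F z) + R z \<le> ereal (F y) + R y"
    and smooth: "\<And>y. F y \<le> F z + G \<bullet> (y - z) + B * (norm (y - z))\<^sup>2"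
  obtains r where "R z = ereal r" and "\<And>y t. R y \<le> ereal t \<Longrightarrow> r - G \<bullet> (y - z) \<le> t"
proof -
  obtain y0 where "R y0 \<noteq> \<infinity>" and "\<And>y. R y \<noteq> -\<infinity>"
    using R by (auto simp: proper_closed_convex_def)
  with minimal[of y0] have "R z \<noteq> \<infinity>" "R z \<noteq> -\<infinity>"
    by (auto simp: ereal_plus_eq_PInfty)
  then obtain r where r: "R z = ereal r" by (cases "R z") auto
  have "r - G \<bullet> (y - z) \<le> t" if t: "R y \<le> ereal t" for y t
  proof -
    define A where "A = G \<bullet> (y - z) + (t - r)"
    define K where "K = B * (norm (y - z))\<^sup>2"
    have step: "0 \<le> A + s * K" if s: "0 < s" "s < 1" for s
    proof -
      define w where "w = (1 - s) *\<^sub>R z + s *\<^sub>R y"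
      have w: "w - z = s *\<^sub>R (y - z)" by (simp add: w_def algebra_simps)
      have "(1 - s) *\<^sub>R (z, r) + s *\<^sub>R (y, t) \<in> ereal_epigraph R"
        using R s r t
        by (intro convexD[of "ereal_epigraph R"]) (auto simp: proper_closed_convex_def ereal_epigraph_def)
      then have "R w \<le> ereal ((1 - s) * r + s * t)"
        by (simp add: ereal_epigraph_def w_def)
      then have "ereal (F w) + R w \<le> ereal (F w + ((1 - s) * r + s * t))"
        by (metis add_left_mono plus_ereal.simps(1))
      with minimal[of w] have "ereal (F z + r) \<le> ereal (F w + ((1 - s) * r + s * t))"
        using r order_trans by fastforce
      then have "F z + r \<le> F w + ((1 - s) * r + s * t)" by simp
      also have "F w \<le> F z + s * (G \<bullet> (y - z)) + s\<^sup>2 * K"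
        using smooth[of w] by (simp add: w K_def power_mult_distrib mult.left_commute)
      finally have "0 \<le> s * (A + s * K)" by (simp add: A_def algebra_simps power2_eq_square)
      then show ?thesis using s by (simp add: zero_le_mult_iff)
    qed
    have "((\<lambda>s. A + s * K) \<longlongrightarrow> A + 0 * K) (at_right 0)"
      by (intro tendsto_intros)
    moreover have "\<forall>\<^sub>F s in at_right 0. 0 \<le> A + s * K"
      using step by (auto simp: eventually_at_right[OF zero_less_one] intro!: exI[of _ 1])
    ultimately have "0 \<le> A + 0 * K"
      by (intro tendsto_lowerbound) auto
    then show ?thesis by (simp add: A_def)
  qed
  with r that show thesis by blast
qed

text \<open>The proximal objective attains its minimum: on the closed epigraph of \<open>R\<close> it becomes the continuous
function \<open>obj'\<close>, and an affine minorant of \<open>R\<close> bounds the sublevel sets of \<open>obj'\<close>. In the application the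
minorant is the subgradient inequality at the minimizer of the whole problem.\<close>

lemma prox_minimizes:
  fixes R :: "'a::euclidean_space \<Rightarrow> ereal"
  assumes R: "proper_closed_convex R" and \<gamma>: "0 < \<gamma>"
    and z: "R z = ereal r" and minorant: "\<And>y t. R y \<le> ereal t \<Longrightarrow> r - G \<bullet> (y - z) \<le> t"
  shows "ereal \<gamma> * R (prox \<gamma> R x) + ereal (1 / 2 * (norm (prox \<gamma> R x - x))\<^sup>2)
    \<le> ereal \<gamma> * R y + ereal (1 / 2 * (norm (y - x))\<^sup>2)"
proof -
  let ?obj = "\<lambda>y. ereal \<gamma> * R y + ereal (1 / 2 * (norm (y - x))\<^sup>2)"
  define obj' where "obj' = (\<lambda>p :: 'a \<times> real. \<gamma> * snd p + 1 / 2 * (norm (fst p - x))\<^sup>2)"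
  define C where "C = obj' (z, r)"
  define K where "K = ereal_epigraph R \<inter> {p. obj' p \<le> C}"
  have cont: "continuous_on UNIV obj'"
    unfolding obj'_def by (intro continuous_intros)
  have "closed K"
    unfolding K_def using R
    by (intro closed_Int closed_Collect_le cont continuous_on_const)
       (auto simp: proper_closed_convex_def)
  moreover have "bounded K"
  proof -
    \<comment> \<open>Completing the square in the minorant plus the quadratic term shows that \<open>y\<close> stays within
      distance \<open>sqrt \<rho>\<close> of \<open>x + \<gamma> *\<^sub>R G\<close>.\<close>
    define \<rho> where "\<rho> = 2 * (C - \<gamma> * r + \<gamma> * (G \<bullet> (x - z))) + (norm (\<gamma> *\<^sub>R G))\<^sup>2"
    define b where "b = sqrt \<rho>"
    define l where "l = r - norm G * (b + norm (x + \<gamma> *\<^sub>R G - z))"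
    have "y \<in> cball (x + \<gamma> *\<^sub>R G) b \<and> t \<in> {l..C / \<gamma>}" if "(y, t) \<in> K" for y t
    proof
      have t: "r - G \<bullet> (y - z) \<le> t" and C: "\<gamma> * t + 1 / 2 * (norm (y - x))\<^sup>2 \<le> C"
        using that minorant by (auto simp: K_def ereal_epigraph_def obj'_def)
      have "\<gamma> * (r - G \<bullet> (y - z)) \<le> \<gamma> * t" using t \<gamma> by simp
      then have "(norm (y - x - \<gamma> *\<^sub>R G))\<^sup>2 \<le> \<rho>"
        using C unfolding \<rho>_def power2_norm_eq_inner
        by (simp add: inner_diff_left inner_diff_right inner_commute algebra_simps)
      then have n: "norm (y - x - \<gamma> *\<^sub>R G) \<le> b"
        unfolding b_def by (rule real_le_rsqrt)
      then show "y \<in> cball (x + \<gamma> *\<^sub>R G) b"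
        by (simp add: dist_norm norm_minus_commute algebra_simps)
      have "G \<bullet> (y - z) \<le> norm G * norm ((y - x - \<gamma> *\<^sub>R G) + (x + \<gamma> *\<^sub>R G - z))"
        using norm_cauchy_schwarz[of G "y - z"] by simp
      also have "\<dots> \<le> norm G * (b + norm (x + \<gamma> *\<^sub>R G - z))"
        using n by (intro mult_left_mono norm_triangle_le add_right_mono) auto
      finally have "l \<le> t" using t by (simp add: l_def)
      moreover have "\<gamma> * t \<le> C" using C zero_le_power2[of "norm (y - x)"] by linarith
      ultimately show "t \<in> {l..C / \<gamma>}" using \<gamma> by (simp add: field_simps)
    qed
    then have "K \<subseteq> cball (x + \<gamma> *\<^sub>R G) b \<times> {l..C / \<gamma>}" by auto
    then show ?thesis by (rule bounded_subset[rotated]) (intro bounded_Times bounded_cball bounded_closed_interval)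
  qed
  ultimately have "compact K" by (simp add: compact_eq_bounded_closed)
  moreover have zr: "(z, r) \<in> K" by (simp add: K_def C_def ereal_epigraph_def z)
  ultimately obtain q where "q \<in> K" and "\<forall>p\<in>K. obj' q \<le> obj' p"
    using continuous_attains_inf[OF _ _ continuous_on_subset[OF cont subset_UNIV], of K] by blast
  then obtain m s where ms: "(m, s) \<in> K" and inf: "\<And>p. p \<in> K \<Longrightarrow> obj' (m, s) \<le> obj' p"
    by (cases q) blast
  have inf': "obj' (m, s) \<le> obj' p" if "p \<in> ereal_epigraph R" for p
    using inf[of p] inf[OF zr] that by (fastforce simp: K_def C_def)
  have "?obj m \<le> ?obj y" for y
  proof (cases "R y")
    case (real t)
    have "R m \<le> ereal s" using ms by (simp add: K_def ereal_epigraph_def)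
    then have "ereal \<gamma> * R m \<le> ereal \<gamma> * ereal s" using \<gamma> by (intro ereal_mult_left_mono) auto
    then have "?obj m \<le> ereal (obj' (m, s))"
      using add_right_mono[of "ereal \<gamma> * R m" "ereal \<gamma> * ereal s" "ereal (1 / 2 * (norm (m - x))\<^sup>2)"]
      by (simp add: obj'_def)
    also have "\<dots> \<le> ereal (obj' (y, t))" using inf'[of "(y, t)"] real by (simp add: ereal_epigraph_def)
    also have "\<dots> = ?obj y" using real by (simp add: obj'_def)
    finally show ?thesis .
  next
    case PInf
    then show ?thesis using \<gamma> by simp
  next
    case MInf
    then show ?thesis using R by (simp add: proper_closed_convex_def)
  qed
  then have "is_arg_min ?obj (\<lambda>_. True) m" by (auto simp: is_arg_min_linorder)
  then have "is_arg_min ?obj (\<lambda>_. True) (prox \<gamma> R x)"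
    unfolding prox_def arg_min_def by (rule someI)
  then show ?thesis by (auto simp: is_arg_min_linorder)
qed

text \<open>A minimizer \<open>z\<close> of \<open>F + R\<close> is the proximal point of \<open>z - \<gamma> *\<^sub>R G\<close>, and proximal maps are
nonexpansive. The proof adds the two subgradient inequalities of \<open>R\<close>, at \<open>z\<close> and at the proximal point
of \<open>x\<close>, which expresses the monotonicity of the subdifferential.\<close>

lemma prox_step_towards_minimizer:
  fixes R :: "'a::euclidean_space \<Rightarrow> ereal"
  assumes R: "proper_closed_convex R" and \<gamma>: "0 < \<gamma>"
    and minimal: "\<And>y. ereal (F z) + R z \<le> ereal (F y) + R y"
    and smooth: "\<And>y. F y \<le> F z + G \<bullet> (y - z) + B * (norm (y - z))\<^sup>2"
  shows "norm (prox \<gamma> R x - z) \<le> norm (x - (z - \<gamma> *\<^sub>R G))"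
proof -
  obtain r where r: "R z = ereal r" and z: "\<And>y t. R y \<le> ereal t \<Longrightarrow> r - G \<bullet> (y - z) \<le> t"
    using first_order_optimality[OF R minimal smooth] by blast
  define p where "p = prox \<gamma> R x"
  have scaled: "ereal (1 / (2 * \<gamma>) * (norm (q - x))\<^sup>2) + R q
      = ereal (1 / \<gamma>) * (ereal \<gamma> * R q + ereal (1 / 2 * (norm (q - x))\<^sup>2))" for q
    using \<gamma> by (cases "R q") (auto simp: field_simps)
  have p_min: "ereal (1 / (2 * \<gamma>) * (norm (p - x))\<^sup>2) + R p \<le> ereal (1 / (2 * \<gamma>) * (norm (y - x))\<^sup>2) + R y" for y
    unfolding scaled p_def using prox_minimizes[OF R \<gamma> r z, of x y] \<gamma>
    by (intro ereal_mult_left_mono) auto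
  have quadratic: "1 / (2 * \<gamma>) * (norm (y - x))\<^sup>2 \<le> 1 / (2 * \<gamma>) * (norm (p - x))\<^sup>2
      + ((1 / \<gamma>) *\<^sub>R (p - x)) \<bullet> (y - p) + 1 / (2 * \<gamma>) * (norm (y - p))\<^sup>2" for y
    using \<gamma> unfolding power2_norm_eq_inner
    by (simp add: inner_diff_left inner_diff_right inner_commute field_simps)
  obtain s where s: "R p = ereal s"
    and p: "\<And>y t. R y \<le> ereal t \<Longrightarrow> s - ((1 / \<gamma>) *\<^sub>R (p - x)) \<bullet> (y - p) \<le> t"
    using first_order_optimality[OF R p_min quadratic] by blast
  have "0 \<le> ((1 / \<gamma>) *\<^sub>R (p - x) - G) \<bullet> (z - p)"
  proof -
    have "s - ((1 / \<gamma>) *\<^sub>R (p - x)) \<bullet> (z - p) \<le> r" and "r - G \<bullet> (p - z) \<le> s"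
      using p[of z r] z[of p s] r s by simp_all
    moreover have "G \<bullet> (p - z) = - (G \<bullet> (z - p))" by (simp add: inner_diff_right)
    ultimately show ?thesis unfolding inner_diff_left by linarith
  qed
  then have "0 \<le> \<gamma> * (((1 / \<gamma>) *\<^sub>R (p - x) - G) \<bullet> (z - p))" using \<gamma> by simp
  also have "\<dots> = (p - x - \<gamma> *\<^sub>R G) \<bullet> (z - p)"
    using \<gamma> by (simp add: inner_diff_left right_diff_distrib)
  finally have "(norm (p - z))\<^sup>2 \<le> (x - (z - \<gamma> *\<^sub>R G)) \<bullet> (p - z)"
    unfolding power2_norm_eq_inner
    by (simp add: inner_diff_left inner_diff_right inner_add_left inner_commute algebra_simps)
  also have "\<dots> \<le> norm (x - (z - \<gamma> *\<^sub>R G)) * norm (p - z)" by (rule norm_cauchy_schwarz)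
  finally show ?thesis
    unfolding p_def[symmetric] by (cases "norm (p - z) = 0") (auto simp: power2_eq_square)
qed

section \<open>Square-integrable random vectors\<close>

definition square_integrable :: "'w measure \<Rightarrow> ('w \<Rightarrow> 'a::euclidean_space) \<Rightarrow> bool" where
  "square_integrable M X \<longleftrightarrow> X \<in> borel_measurable M \<and> integrable M (\<lambda>w. (norm (X w))\<^sup>2)"

lemma square_integrable_measurable[measurable_dest]:
  "square_integrable M X \<Longrightarrow> X \<in> borel_measurable M"
  by (simp add: square_integrable_def)

lemma square_integrable_norm:
  "square_integrable M X \<Longrightarrow> integrable M (\<lambda>w. (norm (X w))\<^sup>2)"
  by (simp add: square_integrable_def)

lemma square_integrable_bound:
  assumes X: "square_integrable M X" and Y: "Y \<in> borel_measurable M"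
    and le: "\<And>w. w \<in> space M \<Longrightarrow> norm (Y w) \<le> B * norm (X w)"
  shows "square_integrable M Y"
  unfolding square_integrable_def
proof (intro conjI Y)
  have "(norm (Y w))\<^sup>2 \<le> (B * norm (X w))\<^sup>2" if "w \<in> space M" for w
    using le[OF that] by (intro power_mono) auto
  then show "integrable M (\<lambda>w. (norm (Y w))\<^sup>2)"
    using X Y by (intro Bochner_Integration.integrable_bound[OF integrable_mult_right[OF square_integrable_norm[OF X], of "B\<^sup>2"]])
      (auto simp: power_mult_distrib square_integrable_def intro!: AE_I2)
qed

lemma square_integrable_scaleR:
  "square_integrable M X \<Longrightarrow> square_integrable M (\<lambda>w. a *\<^sub>R X w)"
  by (rule square_integrable_bound[where B = "\<bar>a\<bar>"]) auto

lemma square_integrable_inner: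
  assumes X: "square_integrable M X" and Y: "square_integrable M Y"
  shows "integrable M (\<lambda>w. X w \<bullet> Y w)"
proof (rule Bochner_Integration.integrable_bound)
  show "integrable M (\<lambda>w. (norm (X w))\<^sup>2 + (norm (Y w))\<^sup>2)"
    using X Y by (intro Bochner_Integration.integrable_add square_integrable_norm)
  show "(\<lambda>w. X w \<bullet> Y w) \<in> borel_measurable M" using X Y by measurable
  have "\<bar>X w \<bullet> Y w\<bar> \<le> (norm (X w))\<^sup>2 + (norm (Y w))\<^sup>2" for w
  proof -
    have "\<bar>X w \<bullet> Y w\<bar> \<le> norm (X w) * norm (Y w)" by (rule Cauchy_Schwarz_ineq2)
    also have "\<dots> \<le> (norm (X w))\<^sup>2 + (norm (Y w))\<^sup>2"
      using sum_squares_bound[of "norm (X w)" "norm (Y w)"] mult_nonneg_nonneg[OF norm_ge_zero norm_ge_zero, of "X w" "Y w"]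
      unfolding mult.assoc by linarith
    finally show ?thesis .
  qed
  then show "AE w in M. norm (X w \<bullet> Y w) \<le> norm ((norm (X w))\<^sup>2 + (norm (Y w))\<^sup>2)" by simp
qed

lemma square_integrable_add:
  assumes X: "square_integrable M X" and Y: "square_integrable M Y"
  shows "square_integrable M (\<lambda>w. X w + Y w)"
proof -
  have "(norm (X w + Y w))\<^sup>2 = (norm (X w))\<^sup>2 + 2 * (X w \<bullet> Y w) + (norm (Y w))\<^sup>2" for w
    by (simp add: power2_norm_eq_inner inner_add_left inner_add_right inner_commute)
  then show ?thesis
    using assms square_integrable_inner[OF assms] by (auto simp: square_integrable_def)
qed

lemma square_integrable_diff:
  assumes "square_integrable M X" and "square_integrable M Y"
  shows "square_integrable M (\<lambda>w. X w - Y w)"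
  using square_integrable_add[OF assms(1) square_integrable_scaleR[OF assms(2), of "-1"]] by simp

lemma square_integrable_sum:
  assumes "\<And>i. i \<in> I \<Longrightarrow> square_integrable M (X i)"
  shows "square_integrable M (\<lambda>w. \<Sum>i\<in>I. X i w)"
  using assms
proof (induction I rule: infinite_finite_induct)
  case (insert i I)
  then show ?case using square_integrable_add[of M "X i" "\<lambda>w. \<Sum>i\<in>I. X i w"] by simp
qed (simp_all add: square_integrable_def)

lemma (in finite_measure) square_integrable_const: "square_integrable M (\<lambda>_. v)"
  by (simp add: square_integrable_def)

lemma expectation_norm_add_square:
  assumes X: "square_integrable M X" and Y: "square_integrable M Y"
  shows "(LINT w|M. (norm (X w + Y w))\<^sup>2) =
    (LINT w|M. (norm (X w))\<^sup>2) + 2 * (LINT w|M. X w \<bullet> Y w) + (LINT w|M. (norm (Y w))\<^sup>2)"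
proof -
  have "(norm (X w + Y w))\<^sup>2 = (norm (X w))\<^sup>2 + 2 * (X w \<bullet> Y w) + (norm (Y w))\<^sup>2" for w
    by (simp add: power2_norm_eq_inner inner_add_left inner_add_right inner_commute)
  then show ?thesis
    using assms square_integrable_inner[OF assms] by (simp add: square_integrable_norm)
qed

lemma expectation_inner_diff:
  assumes "square_integrable M X" "square_integrable M Y" "square_integrable M Z"
  shows "(LINT w|M. X w \<bullet> (Y w - Z w)) = (LINT w|M. X w \<bullet> Y w) - (LINT w|M. X w \<bullet> Z w)"
  using assms by (simp add: inner_diff_right square_integrable_inner)

lemma expectation_weighted_sum:
  fixes X :: "'w \<Rightarrow> real"
  assumes "integrable M X" and "\<And>i. i \<in> I \<Longrightarrow> integrable M (Y i)"
  shows "(LINT w|M. a * X w + b * (\<Sum>i\<in>I. Y i w)) = a * (LINT w|M. X w) + b * (\<Sum>i\<in>I. LINT w|M. Y i w)"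
  using assms by simp

lemma norm_sum_square_le:
  fixes v :: "'i \<Rightarrow> 'a::real_inner"
  assumes "finite I"
  shows "(norm (\<Sum>i\<in>I. v i))\<^sup>2 \<le> real (card I) * (\<Sum>i\<in>I. (norm (v i))\<^sup>2)"
proof -
  have "(norm (\<Sum>i\<in>I. v i))\<^sup>2 \<le> (\<Sum>i\<in>I. norm (v i))\<^sup>2"
    by (intro power_mono norm_sum) auto
  also have "\<dots> \<le> real (card I) * (\<Sum>i\<in>I. (norm (v i))\<^sup>2)"
    using Cauchy_Schwarz_ineq_sum[of "\<lambda>_. 1" "\<lambda>i. norm (v i)" I] by simp
  finally show ?thesis .
qed

text \<open>Conditional means are coordinatewise, so the pull-out property of \<^const>\<open>real_cond_exp\<close> is applied to
each coordinate of the inner product.\<close>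

lemma expectation_inner_cond_mean:
  fixes X Y V :: "'w \<Rightarrow> 'a::euclidean_space"
  assumes M: "prob_space M" and sub: "subalgebra M F"
    and mean: "has_cond_mean M F X Y"
    and V: "V \<in> borel_measurable F" "square_integrable M V"
    and X: "square_integrable M X" and Y: "square_integrable M Y"
  shows "(LINT w|M. V w \<bullet> X w) = (LINT w|M. V w \<bullet> Y w)"
proof -
  interpret prob_space M by (rule M)
  interpret finite_measure_subalgebra M F by unfold_locales (rule sub)
  have coord: "square_integrable M (\<lambda>w. Z w \<bullet> b)" if "square_integrable M Z" "b \<in> Basis"
    for Z :: "'w \<Rightarrow> 'a" and b
    using that by (intro square_integrable_bound[OF that(1), of _ 1]) (auto intro: Basis_le_norm)
  have prod: "integrable M (\<lambda>w. (V w \<bullet> b) * (Z w \<bullet> b))" if "square_integrable M Z" "b \<in> Basis"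
    for Z :: "'w \<Rightarrow> 'a" and b
    using square_integrable_inner[OF coord[OF V(2) that(2)] coord[OF that]] by simp
  have "(LINT w|M. (V w \<bullet> b) * (X w \<bullet> b)) = (LINT w|M. (V w \<bullet> b) * (Y w \<bullet> b))"
    if b: "b \<in> Basis" for b
  proof -
    have "(LINT w|M. (V w \<bullet> b) * (X w \<bullet> b))
        = (LINT w|M. (V w \<bullet> b) * real_cond_exp M F (\<lambda>w. X w \<bullet> b) w)"
      using V(1) square_integrable_measurable[OF X]
      by (intro real_cond_exp_intg(2)[OF prod[OF X b], symmetric]) simp_all
    also have "\<dots> = (LINT w|M. (V w \<bullet> b) * (Y w \<bullet> b))"
      using mean b V Y by (intro integral_cong_AE) (auto simp: has_cond_mean_def)
    finally show ?thesis .
  qed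
  then have "(\<Sum>b\<in>Basis. LINT w|M. (V w \<bullet> b) * (X w \<bullet> b)) = (\<Sum>b\<in>Basis. LINT w|M. (V w \<bullet> b) * (Y w \<bullet> b))"
    by (rule sum.cong[OF refl])
  moreover have "(LINT w|M. V w \<bullet> Z w) = (\<Sum>b\<in>Basis. LINT w|M. (V w \<bullet> b) * (Z w \<bullet> b))"
    if "square_integrable M Z" for Z :: "'w \<Rightarrow> 'a"
    using prod[OF that] by (subst euclidean_inner) (rule Bochner_Integration.integral_sum)
  ultimately show ?thesis using X Y by simp
qed

section \<open>Quantization with fresh seeds\<close>

text \<open>\<open>G\<close> carries the information available when the seed \<open>\<xi>\<close> is drawn.\<close>

definition (in prob_space) fresh_seed :: "'a measure \<Rightarrow> 'u measure \<Rightarrow> ('a \<Rightarrow> 'u) \<Rightarrow> bool" where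
  "fresh_seed G S \<xi> \<longleftrightarrow> subalgebra M G \<and> \<xi> \<in> measurable M S \<and> distr M S \<xi> = S \<and>
     indep_set (sets G) (sets (vimage_algebra (space M) \<xi> S))"

text \<open>Independence as a product law, with the identity on \<open>G\<close> standing for everything known. By Fubini, the
expectation of a function of the known data and the seed can then be computed by averaging over the seed first.\<close>

lemma (in prob_space) fresh_seed_distr:
  assumes "fresh_seed G S \<xi>"
  shows "distr M (G \<Otimes>\<^sub>M S) (\<lambda>w. (w, \<xi> w)) = distr M G (\<lambda>w. w) \<Otimes>\<^sub>M S"
proof -
  have G: "space G = space M" "sets G \<subseteq> sets M" and \<xi>: "\<xi> \<in> measurable M S" and law: "distr M S \<xi> = S"
    and indep: "indep_set (sets G) (sets (vimage_algebra (space M) \<xi> S))"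
    using assms by (auto simp: fresh_seed_def subalgebra_def)
  have id: "(\<lambda>w. w) \<in> measurable M G" using G by (auto simp: measurable_def)
  have graph: "(\<lambda>w. (w, \<xi> w)) \<in> measurable M (G \<Otimes>\<^sub>M S)"
    using id \<xi> by (rule measurable_Pair)
  interpret GM: prob_space "distr M G (\<lambda>w. w)" by (rule prob_space_distr[OF id])
  interpret S: prob_space S using prob_space_distr[OF \<xi>] by (simp add: law)
  have "distr M G (\<lambda>w. w) \<Otimes>\<^sub>M S = distr M (G \<Otimes>\<^sub>M S) (\<lambda>w. (w, \<xi> w))"
  proof (rule pair_measure_eqI)
    fix A B assume "A \<in> sets (distr M G (\<lambda>w. w))" and B: "B \<in> sets S"
    then have A: "A \<in> sets G" by simp
    then have AM: "A \<inter> space M = A" using sets.sets_into_space[OF A] G by auto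
    have B': "\<xi> -` B \<inter> space M \<in> sets (vimage_algebra (space M) \<xi> S)"
      using B by (rule in_vimage_algebra)
    have "emeasure S B = emeasure M (\<xi> -` B \<inter> space M)"
      using emeasure_distr[OF \<xi> B] by (simp add: law)
    moreover have "(\<lambda>w. (w, \<xi> w)) -` (A \<times> B) \<inter> space M = A \<inter> (\<xi> -` B \<inter> space M)"
      by auto
    then have "emeasure (distr M (G \<Otimes>\<^sub>M S) (\<lambda>w. (w, \<xi> w))) (A \<times> B)
        = emeasure M (A \<inter> (\<xi> -` B \<inter> space M))"
      using emeasure_distr[OF graph pair_measureI[OF A B]] by simp
    ultimately show "emeasure (distr M G (\<lambda>w. w)) A * emeasure S B
        = emeasure (distr M (G \<Otimes>\<^sub>M S) (\<lambda>w. (w, \<xi> w))) (A \<times> B)"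
      using indep_setD[OF indep A B'] A AM emeasure_distr[OF id A]
      by (simp add: emeasure_eq_measure ennreal_mult')
  qed (auto intro: GM.sigma_finite_measure_axioms S.sigma_finite_measure_axioms)
  then show ?thesis by (rule sym)
qed

context prob_space
begin

text \<open>Averaging over the seed first replaces \<open>Q\<close> by its mean and second moment at the known point \<open>D w\<close>. The second
moment is computed with the nonnegative integral, which supplies the integrability that Fubini's theorem
asks for in the unbiasedness.\<close>

lemma fresh_quantization:
  fixes Q :: "'u \<Rightarrow> 'b::euclidean_space \<Rightarrow> 'b"
  assumes Q: "quantization_operator \<omega> S Q" and fresh: "fresh_seed G S \<xi>"
    and D_G: "D \<in> borel_measurable G" and D: "square_integrable M D"
  shows fresh_quantization_square_integrable: "square_integrable M (\<lambda>w. Q (\<xi> w) (D w))"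
    and fresh_quantization_second_moment:
      "expectation (\<lambda>w. (norm (Q (\<xi> w) (D w)))\<^sup>2) \<le> (\<omega> + 1) * expectation (\<lambda>w. (norm (D w))\<^sup>2)"
    and fresh_quantization_unbiased: "V \<in> borel_measurable G \<Longrightarrow> square_integrable M V \<Longrightarrow>
      expectation (\<lambda>w. V w \<bullet> Q (\<xi> w) (D w)) = expectation (\<lambda>w. V w \<bullet> D w)"
proof -
  interpret S: prob_space S using Q by (simp add: quantization_operator_def)
  have sub: "subalgebra M G" and [measurable]: "\<xi> \<in> measurable M S"
    using fresh by (auto simp: fresh_seed_def)
  have [measurable]: "(\<lambda>w. w) \<in> measurable M G" 
    using sub by (auto simp: measurable_def subalgebra_def)
  note [measurable] = D_G
  have \<omega>: "0 \<le> \<omega>" and Q_meas: "(\<lambda>(u, x). Q u x) \<in> borel_measurable (S \<Otimes>\<^sub>M borel)"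
    and mean: "\<And>x. integrable S (\<lambda>u. Q u x)" "\<And>x. (LINT u|S. Q u x) = x"
    and second: "\<And>x. integrable S (\<lambda>u. (norm (Q u x))\<^sup>2)" "\<And>x. (LINT u|S. (norm (Q u x))\<^sup>2) \<le> (\<omega> + 1) * (norm x)\<^sup>2"
    using Q by (auto simp: quantization_operator_def)
  define N where "N = distr M G (\<lambda>w. w)"
  have sets_N[measurable_cong]: "sets N = sets G" by (simp add: N_def)
  interpret N: prob_space N unfolding N_def by (rule prob_space_distr) simp
  interpret NS: pair_prob_space N S ..
  have pair: "distr M (G \<Otimes>\<^sub>M S) (\<lambda>w. (w, \<xi> w)) = N \<Otimes>\<^sub>M S"
    using fresh_seed_distr[OF fresh] by (simp add: N_def)
  have QD[measurable]: "(\<lambda>p. Q (snd p) (D (fst p))) \<in> borel_measurable (G \<Otimes>\<^sub>M S)"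
    using measurable_compose[OF _ Q_meas, of "\<lambda>p. (snd p, D (fst p))" "G \<Otimes>\<^sub>M S"] by simp
  have graph[measurable]: "(\<lambda>w. (w, \<xi> w)) \<in> measurable M (G \<Otimes>\<^sub>M S)" by measurable
  have QM[measurable]: "(\<lambda>w. Q (\<xi> w) (D w)) \<in> borel_measurable M"
    using measurable_compose[OF graph QD] by simp

  have "(\<integral>\<^sup>+w. ennreal ((norm (Q (\<xi> w) (D w)))\<^sup>2) \<partial>M)
      = (\<integral>\<^sup>+p. ennreal ((norm (Q (snd p) (D (fst p))))\<^sup>2) \<partial>distr M (G \<Otimes>\<^sub>M S) (\<lambda>w. (w, \<xi> w)))"
    by (subst nn_integral_distr) auto
  also have "\<dots> = (\<integral>\<^sup>+w. \<integral>\<^sup>+u. ennreal ((norm (Q u (D w)))\<^sup>2) \<partial>S \<partial>N)"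
    unfolding pair by (subst S.nn_integral_fst[symmetric]) auto
  also have "\<dots> \<le> (\<integral>\<^sup>+w. ennreal ((\<omega> + 1) * (norm (D w))\<^sup>2) \<partial>N)"
    using second by (intro nn_integral_mono) (simp add: nn_integral_eq_integral ennreal_leI)
  also have "\<dots> = (\<integral>\<^sup>+w. ennreal ((\<omega> + 1) * (norm (D w))\<^sup>2) \<partial>M)"
    unfolding N_def by (subst nn_integral_distr) auto
  also have "\<dots> = ennreal ((\<omega> + 1) * expectation (\<lambda>w. (norm (D w))\<^sup>2))"
    using \<omega> square_integrable_norm[OF D] by (subst nn_integral_eq_integral) auto
  finally have bound: "(\<integral>\<^sup>+w. ennreal ((norm (Q (\<xi> w) (D w)))\<^sup>2) \<partial>M)
    \<le> ennreal ((\<omega> + 1) * expectation (\<lambda>w. (norm (D w))\<^sup>2))" .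
  then have int: "integrable M (\<lambda>w. (norm (Q (\<xi> w) (D w)))\<^sup>2)"
    by (intro integrableI_nonneg) (auto simp: ennreal_less_top le_less_trans)
  then show sq: "square_integrable M (\<lambda>w. Q (\<xi> w) (D w))"
    by (simp add: square_integrable_def)
  show "expectation (\<lambda>w. (norm (Q (\<xi> w) (D w)))\<^sup>2) \<le> (\<omega> + 1) * expectation (\<lambda>w. (norm (D w))\<^sup>2)"
    using bound int \<omega> by (simp add: nn_integral_eq_integral)

  show "expectation (\<lambda>w. V w \<bullet> Q (\<xi> w) (D w)) = expectation (\<lambda>w. V w \<bullet> D w)"
    if V[measurable]: "V \<in> borel_measurable G" and V_sq: "square_integrable M V"
  proof -
    have "integrable M (\<lambda>w. V w \<bullet> Q (\<xi> w) (D w))"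
      by (rule square_integrable_inner[OF V_sq sq])
    then have "integrable (distr M (G \<Otimes>\<^sub>M S) (\<lambda>w. (w, \<xi> w))) (\<lambda>p. V (fst p) \<bullet> Q (snd p) (D (fst p)))"
      by (subst integrable_distr_eq) auto
    then have int: "integrable (N \<Otimes>\<^sub>M S) (\<lambda>p. V (fst p) \<bullet> Q (snd p) (D (fst p)))"
      by (simp add: pair)
    have "expectation (\<lambda>w. V w \<bullet> Q (\<xi> w) (D w))
        = (LINT p|distr M (G \<Otimes>\<^sub>M S) (\<lambda>w. (w, \<xi> w)). V (fst p) \<bullet> Q (snd p) (D (fst p)))"
      by (subst integral_distr) auto
    also have "\<dots> = (LINT w|N. LINT u|S. V w \<bullet> Q u (D w))"
      unfolding pair using NS.integral_fst'[OF int] by simp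
    also have "\<dots> = (LINT w|N. V w \<bullet> D w)"
      using mean by simp
    also have "\<dots> = expectation (\<lambda>w. V w \<bullet> D w)"
      unfolding N_def by (subst integral_distr) auto
    finally show ?thesis .
  qed
qed

text \<open>The error \<open>Q (\<xi> w) (D w) - D w\<close> is orthogonal to everything known, and applying this to \<open>D\<close> itself shows
that its variance is the second moment of \<open>Q\<close> minus that of \<open>D\<close>, hence at most \<open>\<omega>\<close> times the latter.\<close>

lemma fresh_quantization_error:
  fixes Q :: "'u \<Rightarrow> 'b::euclidean_space \<Rightarrow> 'b"
  assumes Q: "quantization_operator \<omega> S Q" and fresh: "fresh_seed G S \<xi>"
    and D: "D \<in> borel_measurable G" "square_integrable M D"
    and V: "V \<in> borel_measurable G" "square_integrable M V"
  shows "expectation (\<lambda>w. (norm (V w + a *\<^sub>R (Q (\<xi> w) (D w) - D w)))\<^sup>2)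
    \<le> expectation (\<lambda>w. (norm (V w))\<^sup>2) + a\<^sup>2 * \<omega> * expectation (\<lambda>w. (norm (D w))\<^sup>2)"
proof -
  define q where "q = (\<lambda>w. Q (\<xi> w) (D w))"
  have q: "square_integrable M q" unfolding q_def
    by (rule fresh_quantization_square_integrable[OF Q fresh D])
  have unbiased: "expectation (\<lambda>w. Z w \<bullet> q w) = expectation (\<lambda>w. Z w \<bullet> D w)"
    if "Z \<in> borel_measurable G" "square_integrable M Z" for Z
    unfolding q_def by (rule fresh_quantization_unbiased[OF Q fresh D that])
  have e: "square_integrable M (\<lambda>w. q w - D w)" by (intro square_integrable_diff q D)
  have "expectation (\<lambda>w. (norm (q w))\<^sup>2) = expectation (\<lambda>w. (norm (D w))\<^sup>2) + expectation (\<lambda>w. (norm (q w - D w))\<^sup>2)"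
    using expectation_norm_add_square[OF D(2) e] expectation_inner_diff[OF D(2) q D(2)] unbiased[OF D] by simp
  then have var: "expectation (\<lambda>w. (norm (q w - D w))\<^sup>2) \<le> \<omega> * expectation (\<lambda>w. (norm (D w))\<^sup>2)"
    using fresh_quantization_second_moment[OF Q fresh D] by (simp add: q_def algebra_simps)
  have "expectation (\<lambda>w. (norm (V w + a *\<^sub>R (q w - D w)))\<^sup>2)
      = expectation (\<lambda>w. (norm (V w))\<^sup>2) + a\<^sup>2 * expectation (\<lambda>w. (norm (q w - D w))\<^sup>2)"
    using expectation_norm_add_square[OF V(2) square_integrable_scaleR[OF e, of a]]
      expectation_inner_diff[OF V(2) q D(2)] unbiased[OF V] by (simp add: power_mult_distrib)
  also have "\<dots> \<le> expectation (\<lambda>w. (norm (V w))\<^sup>2) + a\<^sup>2 * (\<omega> * expectation (\<lambda>w. (norm (D w))\<^sup>2))"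
    using var by (intro add_left_mono mult_left_mono) auto
  finally show ?thesis by (simp add: q_def algebra_simps)
qed

text \<open>By grouping independent sigma-algebras, the seed of worker \<open>i\<close> is also fresh given \<open>F\<close> together with the
seeds of all other workers. This is what makes quantization errors of distinct workers orthogonal.\<close>

lemma fresh_seed_given_others:
  assumes F: "subalgebra M F" and I: "i \<in> I"
    and meas: "\<And>j. j \<in> I \<Longrightarrow> \<xi> j \<in> measurable M S" and law: "distr M S (\<xi> i) = S"
    and indep: "indep_sets (\<lambda>j. case j of None \<Rightarrow> sets F | Some i \<Rightarrow> sets (vimage_algebra (space M) (\<xi> i) S))
      (insert None (Some ` I))"
  obtains G where "fresh_seed G S (\<xi> i)" and "subalgebra G F"
    and "\<And>j. j \<in> I - {i} \<Longrightarrow> \<xi> j \<in> measurable G S"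
proof -
  let ?E = "\<lambda>j. case j of None \<Rightarrow> sets F | Some i \<Rightarrow> sets (vimage_algebra (space M) (\<xi> i) S)"
  define others where "others = insert None (Some ` (I - {i}))"
  define G where "G = sigma (space M) (\<Union>j\<in>others. ?E j)"
  have seed_sets: "sets (vimage_algebra (space M) (\<xi> j) S) \<subseteq> sets M" if "j \<in> I" for j
    using meas[OF that] by (auto simp: sets_vimage_algebra2 measurable_space dest: measurable_sets)
  have E_M: "(\<Union>j\<in>others. ?E j) \<subseteq> sets M"
    using F seed_sets by (auto simp: others_def subalgebra_def)
  then have sets_G: "sets G = sigma_sets (space M) (\<Union>j\<in>others. ?E j)"
    unfolding G_def by (intro sets_measure_of) (use sets.sets_into_space in blast)
  have space_G: "space G = space M" by (simp add: G_def space_measure_of_conv)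
  have E_G: "?E j \<subseteq> sets G" if "j \<in> others" for j
    unfolding sets_G using that by (blast intro: sigma_sets.Basic)
  have "sets G \<subseteq> sets M" unfolding sets_G using E_M by (rule sets.sigma_sets_subset)
  then have "subalgebra M G" by (simp add: subalgebra_def space_G)
  moreover have "indep_set (sets G) (sets (vimage_algebra (space M) (\<xi> i) S))"
  proof -
    have "indep_sets (\<lambda>b. sigma_sets (space M) (\<Union>j\<in>case_bool others {Some i} b. ?E j)) UNIV"
    proof (rule indep_sets_collect_sigma)
      have "(\<Union>b. case_bool others {Some i} b) = insert None (Some ` I)"
        using I by (auto simp: UNIV_bool others_def)
      then show "indep_sets ?E (\<Union>b. case_bool others {Some i} b)" using indep by simp
      show "Int_stable (?E j)" for j by (auto simp: Int_stable_def split: option.split)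
      show "disjoint_family_on (case_bool others {Some i}) UNIV"
        by (auto simp: disjoint_family_on_def others_def split: bool.splits)
    qed
    moreover have "sigma_sets (space M) (sets (vimage_algebra (space M) (\<xi> i) S)) = sets (vimage_algebra (space M) (\<xi> i) S)"
      using sets.sigma_sets_eq[of "vimage_algebra (space M) (\<xi> i) S"] by simp
    ultimately show ?thesis
      unfolding indep_set_def by (elim indep_sets_mono_sets) (auto simp: sets_G split: bool.split)
  qed
  ultimately have "fresh_seed G S (\<xi> i)" using meas[OF I] law by (simp add: fresh_seed_def)
  moreover have "subalgebra G F" using E_G[of None] F by (auto simp: others_def subalgebra_def space_G)
  moreover have "\<xi> j \<in> measurable G S" if "j \<in> I - {i}" for j
  proof -
    have "\<xi> j \<in> space M \<rightarrow> space S" using meas that by (auto simp: measurable_def)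
    then have "\<xi> j \<in> measurable (vimage_algebra (space M) (\<xi> j) S) S" by (rule measurable_vimage_algebra1)
    moreover have "subalgebra G (vimage_algebra (space M) (\<xi> j) S)"
      using E_G[of "Some j"] that by (auto simp: others_def subalgebra_def space_G)
    ultimately show ?thesis by (rule measurable_from_subalg[rotated])
  qed
  ultimately show thesis by (rule that)
qed

text \<open>The errors are added one worker at a time: the partial sum over \<open>J\<close> is known once the seeds in \<open>J\<close> are, so
a further error raises the second moment by its own variance only.\<close>

lemma independent_quantization_errors:
  fixes Q :: "'u \<Rightarrow> 'b::euclidean_space \<Rightarrow> 'b"
  assumes Q: "quantization_operator \<omega> S Q" and F: "subalgebra M F" and I: "finite I"
    and meas: "\<And>i. i \<in> I \<Longrightarrow> \<xi> i \<in> measurable M S" and law: "\<And>i. i \<in> I \<Longrightarrow> distr M S (\<xi> i) = S"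
    and indep: "indep_sets (\<lambda>j. case j of None \<Rightarrow> sets F | Some i \<Rightarrow> sets (vimage_algebra (space M) (\<xi> i) S))
      (insert None (Some ` I))"
    and D: "\<And>i. i \<in> I \<Longrightarrow> D i \<in> borel_measurable F" "\<And>i. i \<in> I \<Longrightarrow> square_integrable M (D i)"
    and V: "V \<in> borel_measurable F" "square_integrable M V"
  shows "expectation (\<lambda>w. (norm (V w + (\<Sum>i\<in>I. a *\<^sub>R (Q (\<xi> i w) (D i w) - D i w))))\<^sup>2)
    \<le> expectation (\<lambda>w. (norm (V w))\<^sup>2) + a\<^sup>2 * \<omega> * (\<Sum>i\<in>I. expectation (\<lambda>w. (norm (D i w))\<^sup>2))"
proof -
  define e where "e = (\<lambda>i w. a *\<^sub>R (Q (\<xi> i w) (D i w) - D i w))"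
  have Q_meas: "(\<lambda>(u, x). Q u x) \<in> borel_measurable (S \<Otimes>\<^sub>M borel)"
    using Q by (simp add: quantization_operator_def)
  have e_meas: "e j \<in> borel_measurable G" if "subalgebra G F" "\<xi> j \<in> measurable G S" "j \<in> I" for j G
  proof -
    have [measurable]: "D j \<in> borel_measurable G" "\<xi> j \<in> measurable G S"
      using measurable_from_subalg[OF that(1) D(1)[OF that(3)]] that(2) by auto
    have "(\<lambda>w. Q (\<xi> j w) (D j w)) \<in> borel_measurable G"
      using measurable_compose[OF _ Q_meas, of "\<lambda>w. (\<xi> j w, D j w)" G] by simp
    then show ?thesis unfolding e_def by measurable
  qed
  have "square_integrable M (\<lambda>w. V w + (\<Sum>i\<in>J. e i w)) \<and>
      expectation (\<lambda>w. (norm (V w + (\<Sum>i\<in>J. e i w)))\<^sup>2)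
        \<le> expectation (\<lambda>w. (norm (V w))\<^sup>2) + a\<^sup>2 * \<omega> * (\<Sum>i\<in>J. expectation (\<lambda>w. (norm (D i w))\<^sup>2))"
    if "J \<subseteq> I" for J
    using finite_subset[OF that I] that
  proof (induction J rule: finite_induct)
    case empty
    then show ?case using V by simp
  next
    case (insert i J)
    then have i: "i \<in> I" and J: "J \<subseteq> I - {i}" by auto
    obtain G where G: "fresh_seed G S (\<xi> i)" "subalgebra G F"
      and others: "\<And>j. j \<in> I - {i} \<Longrightarrow> \<xi> j \<in> measurable G S"
      using fresh_seed_given_others[OF F i meas law[OF i] indep] by blast
    define W where "W = (\<lambda>w. V w + (\<Sum>i\<in>J. e i w))"
    have W: "W \<in> borel_measurable G" "square_integrable M W"
      unfolding W_def using insert J others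
      by (auto intro!: borel_measurable_add borel_measurable_sum e_meas G(2) measurable_from_subalg[OF G(2) V(1)])
    have Di: "D i \<in> borel_measurable G" "square_integrable M (D i)"
      using measurable_from_subalg[OF G(2) D(1)[OF i]] D(2)[OF i] by auto
    have "V w + (\<Sum>i\<in>insert i J. e i w) = W w + e i w" for w
      using insert by (simp add: W_def algebra_simps)
    moreover have "square_integrable M (\<lambda>w. W w + e i w)"
      unfolding e_def using fresh_quantization_square_integrable[OF Q G(1) Di] W Di
      by (intro square_integrable_add square_integrable_scaleR square_integrable_diff) auto
    moreover have "expectation (\<lambda>w. (norm (W w + e i w))\<^sup>2)
        \<le> expectation (\<lambda>w. (norm (V w))\<^sup>2)
          + a\<^sup>2 * \<omega> * (\<Sum>i\<in>insert i J. expectation (\<lambda>w. (norm (D i w))\<^sup>2))"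
      using fresh_quantization_error[OF Q G(1) Di W, of a] insert
      unfolding e_def W_def by (simp add: algebra_simps)
    ultimately show ?case by presburger
  qed
  from this[OF order_refl] show ?thesis by (simp add: e_def)
qed

end

section \<open>Measurability of the iterates\<close>

lemma measurable_sigma_generator:
  assumes "sets (vimage_algebra \<Omega> X N) \<subseteq> \<A>" and "\<A> \<subseteq> Pow \<Omega>" and "X \<in> \<Omega> \<rightarrow> space N"
  shows "X \<in> measurable (sigma \<Omega> \<A>) N"
proof -
  have "sets (vimage_algebra \<Omega> X N) \<subseteq> sets (sigma \<Omega> \<A>)"
    using assms(1,2) by (auto simp: sets_measure_of)
  then have "subalgebra (sigma \<Omega> \<A>) (vimage_algebra \<Omega> X N)"
    by (simp add: subalgebra_def space_measure_of_conv)
  then show ?thesis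
    using measurable_vimage_algebra1[OF assms(3)] by (rule measurable_from_subalg)
qed

lemma sets_vimage_algebra_Pow: "sets (vimage_algebra \<Omega> X N) \<subseteq> Pow \<Omega>"
  by (metis sets.space_closed space_vimage_algebra)

context diana
begin

abbreviation "hist k \<equiv> history M S n x h g \<xi> k"
abbreviation "pre k \<equiv> pre_quantization M S n x h g \<xi> k"

lemma space_history [simp]: "space (hist k) = space M"
  by (simp add: history_def space_measure_of_conv)

lemma space_pre_quantization [simp]: "space (pre k) = space M"
  by (simp add: pre_quantization_def space_measure_of_conv)

lemma sets_history_Pow: "sets (hist k) \<subseteq> Pow (space M)"
  using sets.space_closed[of "hist k"] by simp

lemma subalgebra_pre_quantization_history: "subalgebra (pre k) (hist k)"
proof -
  have "sets (hist k) \<union> (\<Union>i\<in>{1..n}. sets (vimage_algebra (space M) (g k i) borel)) \<subseteq> Pow (space M)"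
    by (intro Un_least UN_least sets_vimage_algebra_Pow sets_history_Pow)
  then have "sets (hist k) \<subseteq> sets (pre k)"
    unfolding pre_quantization_def by (auto simp: sets_measure_of)
  then show ?thesis by (simp add: subalgebra_def)
qed

text \<open>That \<open>pre k\<close> consists of events is part of the independence assumption on the seeds. Hence
  the iterates, whose preimages belong to \<open>pre k\<close>, are random variables.\<close>

lemma subalgebra_pre_quantization: "subalgebra M (pre k)"
proof -
  have "sets (pre k) \<subseteq> events"
    using fresh_seeds[of k] unfolding indep_sets_def by auto
  then show ?thesis by (simp add: subalgebra_def)
qed

lemma subalgebra_history: "subalgebra M (hist k)"
  using subalgebra_pre_quantization[of k] subalgebra_pre_quantization_history[of k]
  by (auto simp: subalgebra_def)

lemma measurable_x_history: "x k \<in> borel_measurable (hist k)"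
  unfolding history_def
  by (rule measurable_sigma_generator)
     (intro le_supI1 order_refl, intro Un_least UN_least sets_vimage_algebra_Pow, simp)

lemma measurable_h_history: "i \<in> {1..n} \<Longrightarrow> h k i \<in> borel_measurable (hist k)"
  unfolding history_def
  by (rule measurable_sigma_generator)
     (rule le_supI1[OF le_supI2[OF SUP_upper]], assumption, intro Un_least UN_least sets_vimage_algebra_Pow, simp)

lemma measurable_g_pre_quantization: "i \<in> {1..n} \<Longrightarrow> g k i \<in> borel_measurable (pre k)"
  unfolding pre_quantization_def
  by (rule measurable_sigma_generator)
     (rule le_supI2[OF SUP_upper], assumption, intro Un_least UN_least sets_vimage_algebra_Pow sets_history_Pow, simp)

end

section \<open>One iteration in expectation\<close>

locale diana_convergence = diana M S Q n f R \<alpha> \<gamma> x\<^sub>0 h\<^sub>0 x h g \<xi>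
  for M :: "'w measure" and S :: "'u measure" and Q :: "'u \<Rightarrow> 'a::euclidean_space \<Rightarrow> 'a"
    and n :: nat and f :: "nat \<Rightarrow> 'a \<Rightarrow> real" and R :: "'a \<Rightarrow> ereal"
    and \<alpha> \<gamma> :: real and x\<^sub>0 :: 'a and h\<^sub>0 :: "nat \<Rightarrow> 'a"
    and x :: "nat \<Rightarrow> 'w \<Rightarrow> 'a" and h g :: "nat \<Rightarrow> nat \<Rightarrow> 'w \<Rightarrow> 'a"
    and \<xi> :: "nat \<Rightarrow> nat \<Rightarrow> 'w \<Rightarrow> 'u" +
  fixes \<mu> L \<omega> c :: real and \<sigma> :: "nat \<Rightarrow> real" and xstar :: 'a
  assumes n: "1 \<le> n"
    and strongly_convex: "\<And>i. i \<in> {1..n} \<Longrightarrow> strongly_convex \<mu> (f i)"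
    and smooth: "\<And>i. i \<in> {1..n} \<Longrightarrow> L_smooth L (f i)"
    and R: "proper_closed_convex R"
    and minimizer: "is_arg_min (\<lambda>z. ereal (1 / real n * (\<Sum>i=1..n. f i z)) + R z) (\<lambda>_. True) xstar"
    and quantization: "quantization_operator \<omega> S Q"
    and noise_integrable: "\<And>k i. i \<in> {1..n} \<Longrightarrow> integrable M (\<lambda>w. (norm (g k i w - grad (f i) (x k w)))\<^sup>2)"
    and noise_bound: "\<And>k i. i \<in> {1..n} \<Longrightarrow> (LINT w|M. (norm (g k i w - grad (f i) (x k w)))\<^sup>2) \<le> (\<sigma> i)\<^sup>2"
    and \<alpha>_pos: "0 < \<alpha>" and \<gamma>_pos: "0 < \<gamma>"
    and \<alpha>_le: "\<alpha> \<le> 1 / (\<omega> + 1)"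
begin

abbreviation "hstar i \<equiv> grad (f i) xstar"
abbreviation "local_grad k i w \<equiv> grad (f i) (x k w)"
abbreviation "\<Delta> k i w \<equiv> g k i w - h k i w"
abbreviation "q k i w \<equiv> Q (\<xi> k i w) (\<Delta> k i w)"

lemma \<omega>_nonneg: "0 \<le> \<omega>"
  using quantization by (simp add: quantization_operator_def)

lemma \<mu>_pos: "0 < \<mu>" and L_pos: "0 < L" and \<mu>_le_L: "\<mu> \<le> L"
  using strongly_convex[of 1] smooth[of 1] strong_convexity_le_smoothness[of \<mu> "f 1" L] n
  by (auto simp: strongly_convex_def L_smooth_def)

text \<open>The quadratic upper bounds of the \<open>f i\<close> at \<open>xstar\<close> average to one for the mean of the \<open>f i\<close>, with the mean
of the gradients as slope.\<close>

lemma prox_step: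
  "norm (prox \<gamma> R y - xstar) \<le> norm (y - (xstar - \<gamma> *\<^sub>R ((1 / real n) *\<^sub>R (\<Sum>i=1..n. hstar i))))"
proof (rule prox_step_towards_minimizer[OF R \<gamma>_pos])
  show "ereal (1 / real n * (\<Sum>i=1..n. f i xstar)) + R xstar
      \<le> ereal (1 / real n * (\<Sum>i=1..n. f i y)) + R y" for y
    using minimizer by (auto simp: is_arg_min_linorder)
  show "1 / real n * (\<Sum>i=1..n. f i y) \<le> 1 / real n * (\<Sum>i=1..n. f i xstar)
      + ((1 / real n) *\<^sub>R (\<Sum>i=1..n. hstar i)) \<bullet> (y - xstar) + L / 2 * (norm (y - xstar))\<^sup>2" for y
  proof -
    have "(\<Sum>i=1..n. f i y) \<le> (\<Sum>i=1..n. f i xstar + hstar i \<bullet> (y - xstar) + L / 2 * (norm (y - xstar))\<^sup>2)"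
      using smooth by (intro sum_mono) (auto simp: L_smooth_def norm_minus_commute)
    also have "\<dots> = (\<Sum>i=1..n. f i xstar) + (\<Sum>i=1..n. hstar i) \<bullet> (y - xstar)
        + real n * (L / 2 * (norm (y - xstar))\<^sup>2)"
      by (simp add: sum.distrib inner_sum_left)
    finally show ?thesis using n by (simp add: field_simps)
  qed
qed

lemma measurable_grad_history: "i \<in> {1..n} \<Longrightarrow> (\<lambda>w. local_grad k i w) \<in> borel_measurable (hist k)"
  by (rule measurable_compose[OF measurable_x_history grad_borel_measurable[OF strongly_convex smooth]])

lemma measurable_history_M: "X \<in> borel_measurable (hist k) \<Longrightarrow> X \<in> borel_measurable M"
  by (rule measurable_from_subalg[OF subalgebra_history])

lemma square_integrable_noise:
  assumes "i \<in> {1..n}" shows "square_integrable M (\<lambda>w. g k i w - local_grad k i w)"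
  using noise_integrable[OF assms] gradient_measurable[OF assms]
    measurable_history_M[OF measurable_grad_history[OF assms]]
  by (simp add: square_integrable_def)

lemma square_integrable_gradients:
  assumes x: "square_integrable M (x k)" and i: "i \<in> {1..n}"
  shows "square_integrable M (\<lambda>w. local_grad k i w)" and "square_integrable M (g k i)"
proof -
  have "square_integrable M (\<lambda>w. local_grad k i w - hstar i)"
    using grad_lipschitz[OF strongly_convex smooth, OF i i]
      measurable_history_M[OF measurable_grad_history[OF i]]
    by (intro square_integrable_bound[OF square_integrable_diff[OF x square_integrable_const], of _ "\<mu> + L" xstar])
       auto
  from square_integrable_add[OF this square_integrable_const, of "hstar i"]
  show grad: "square_integrable M (\<lambda>w. local_grad k i w)" by simp
  from square_integrable_add[OF square_integrable_noise[OF i, of k] this]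
  show "square_integrable M (g k i)" by simp
qed

lemma fresh_seed_pre_quantization:
  assumes i: "i \<in> {1..n}"
  shows "fresh_seed (pre k) S (\<xi> k i)"
proof -
  have "indep_sets (\<lambda>j. case j of None \<Rightarrow> sets (pre k) | Some i \<Rightarrow> sets (vimage_algebra (space M) (\<xi> k i) S))
      (insert None (Some ` {1..n}))" by (rule fresh_seeds)
  from fresh_seed_given_others[OF subalgebra_pre_quantization i seed_measurable seed_law[OF i] this]
  obtain G where "fresh_seed G S (\<xi> k i)" "subalgebra G (pre k)" by blast
  then have "sets (pre k) \<subseteq> sets G"
    and indep: "indep_set (sets G) (sets (vimage_algebra (space M) (\<xi> k i) S))"
    by (auto simp: fresh_seed_def subalgebra_def)
  then have "indep_set (sets (pre k)) (sets (vimage_algebra (space M) (\<xi> k i) S))"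
    unfolding indep_set_def by (elim indep_sets_mono_sets) (simp split: bool.split)
  then show ?thesis
    using subalgebra_pre_quantization seed_measurable[OF i] seed_law[OF i] by (simp add: fresh_seed_def)
qed

lemma measurable_history_pre: "X \<in> borel_measurable (hist k) \<Longrightarrow> X \<in> borel_measurable (pre k)"
  by (rule measurable_from_subalg[OF subalgebra_pre_quantization_history])

lemma measurable_\<Delta>: "i \<in> {1..n} \<Longrightarrow> (\<lambda>w. \<Delta> k i w) \<in> borel_measurable (pre k)"
  using measurable_g_pre_quantization measurable_history_pre[OF measurable_h_history] by measurable

text \<open>Each update is bounded by square-integrable quantities: gradients are Lipschitz, quantization has a
second moment, and the proximal step does not move further from \<open>xstar\<close> than its argument from
the fixed reference point.\<close>

lemma iterates_square_integrable:
  "square_integrable M (x k) \<and> (\<forall>i\<in>{1..n}. square_integrable M (h k i))"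
proof (induction k)
  case 0
  have "square_integrable M (x 0)"
    using x_init measurable_history_M[OF measurable_x_history]
    by (intro square_integrable_bound[OF square_integrable_const[of x\<^sub>0], of _ 1]) auto
  moreover have "square_integrable M (h 0 i)" if "i \<in> {1..n}" for i
    using h_init that measurable_history_M[OF measurable_h_history[OF that]]
    by (intro square_integrable_bound[OF square_integrable_const[of "h\<^sub>0 i"], of _ 1]) auto
  ultimately show ?case by blast
next
  case (Suc k)
  then have x: "square_integrable M (x k)" and h: "\<And>i. i \<in> {1..n} \<Longrightarrow> square_integrable M (h k i)" by auto
  have q: "square_integrable M (\<lambda>w. q k i w)" if i: "i \<in> {1..n}" for i
    by (rule fresh_quantization_square_integrable[OF quantization fresh_seed_pre_quantization[OF i]
        measurable_\<Delta>[OF i] square_integrable_diff[OF square_integrable_gradients(2)[OF x i] h[OF i]]])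
  have "square_integrable M (h (Suc k) i)" if i: "i \<in> {1..n}" for i
    using h_step[OF i] measurable_history_M[OF measurable_h_history[OF i]]
    by (intro square_integrable_bound[OF square_integrable_add[OF h[OF i] square_integrable_scaleR[OF q[OF i], of \<alpha>]], of _ 1])
       auto
  moreover have "square_integrable M (\<lambda>w. x (Suc k) w - xstar)"
  proof (rule square_integrable_bound)
    let ?v = "xstar - \<gamma> *\<^sub>R ((1 / real n) *\<^sub>R (\<Sum>i=1..n. hstar i))"
    show "square_integrable M (\<lambda>w. x k w - \<gamma> *\<^sub>R ((1 / real n) *\<^sub>R (\<Sum>i=1..n. h k i w + q k i w)) - ?v)"
      using x h q by (intro square_integrable_diff square_integrable_scaleR square_integrable_sum
          square_integrable_add square_integrable_const) auto
    show "norm (x (Suc k) w - xstar) \<le> 1 * norm (x k w - \<gamma> *\<^sub>R ((1 / real n) *\<^sub>R (\<Sum>i=1..n. h k i w + q k i w)) - ?v)"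
      if "w \<in> space M" for w
      unfolding x_step[OF that] mult_1 by (rule prox_step)
    show "(\<lambda>w. x (Suc k) w - xstar) \<in> borel_measurable M"
      using measurable_history_M[OF measurable_x_history] by measurable
  qed
  from square_integrable_add[OF this square_integrable_const, of xstar]
  have "square_integrable M (x (Suc k))" by simp
  ultimately show ?case by blast
qed

lemma square_integrable_x: "square_integrable M (x k)"
  and square_integrable_h: "i \<in> {1..n} \<Longrightarrow> square_integrable M (h k i)"
  using iterates_square_integrable by auto

lemmas square_integrable_grad = square_integrable_gradients(1)[OF square_integrable_x]
lemmas square_integrable_g = square_integrable_gradients(2)[OF square_integrable_x]
lemmas square_integrable_iterates = square_integrable_x square_integrable_h
  square_integrable_grad square_integrable_g square_integrable_noise
  square_integrable_diff square_integrable_const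

lemma noise_orthogonal:
  assumes i: "i \<in> {1..n}" and V: "V \<in> borel_measurable (hist k)" "square_integrable M V"
  shows "expectation (\<lambda>w. V w \<bullet> (g k i w - local_grad k i w)) = 0"
  using expectation_inner_cond_mean[OF prob_space_axioms subalgebra_history gradient_unbiased[OF i] V
      square_integrable_g[OF i] square_integrable_grad[OF i]]
    expectation_inner_diff[OF V(2) square_integrable_g[OF i] square_integrable_grad[OF i]]
  by simp

text \<open>Bias-variance decomposition of a stochastic gradient around a vector known from the history.\<close>

lemma noise_adds_variance:
  assumes i: "i \<in> {1..n}" and V: "V \<in> borel_measurable (hist k)" "square_integrable M V"
  shows "expectation (\<lambda>w. (norm (g k i w - V w))\<^sup>2) \<le> expectation (\<lambda>w. (norm (local_grad k i w - V w))\<^sup>2) + (\<sigma> i)\<^sup>2"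
proof -
  have W: "(\<lambda>w. local_grad k i w - V w) \<in> borel_measurable (hist k)" "square_integrable M (\<lambda>w. local_grad k i w - V w)"
    using measurable_grad_history[OF i, of k] V square_integrable_grad[OF i]
    by (auto intro: square_integrable_diff)
  have "expectation (\<lambda>w. (norm (g k i w - V w))\<^sup>2)
      = expectation (\<lambda>w. (norm ((local_grad k i w - V w) + (g k i w - local_grad k i w)))\<^sup>2)" by simp
  also have "\<dots> = expectation (\<lambda>w. (norm (local_grad k i w - V w))\<^sup>2) + expectation (\<lambda>w. (norm (g k i w - local_grad k i w))\<^sup>2)"
    unfolding expectation_norm_add_square[OF W(2) square_integrable_noise[OF i]] noise_orthogonal[OF i W] by simp
  finally show ?thesis using noise_bound[OF i, of k] by simp
qed

definition "err_x k = expectation (\<lambda>w. (norm (x k w - xstar))\<^sup>2)"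
definition "err_h k i = expectation (\<lambda>w. (norm (h k i w - hstar i))\<^sup>2)"
definition "err_grad k i = expectation (\<lambda>w. (norm (local_grad k i w - hstar i))\<^sup>2)"

text \<open>Expanding the square, the condition \<open>\<alpha> * (\<omega> + 1) \<le> 1\<close> turns \<open>\<alpha>\<^sup>2 * E \<parallel>Q \<Delta>\<parallel>\<^sup>2\<close> into at most \<open>\<alpha> * E \<parallel>\<Delta>\<parallel>\<^sup>2\<close>.
With \<open>\<Delta> = (g - h\<^sup>*) - (h - h\<^sup>*)\<close>, the term \<open>2 * (h - h\<^sup>*) \<bullet> \<Delta> + \<parallel>\<Delta>\<parallel>\<^sup>2\<close> equals \<open>\<parallel>g - h\<^sup>*\<parallel>\<^sup>2 - \<parallel>h - h\<^sup>*\<parallel>\<^sup>2\<close>, so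
the memory moves to a convex combination of its old error and the error of the gradient.\<close>

lemma err_h_step:
  assumes i: "i \<in> {1..n}"
  shows "err_h (Suc k) i \<le> (1 - \<alpha>) * err_h k i + \<alpha> * (err_grad k i + (\<sigma> i)\<^sup>2)"
proof -
  have D: "(\<lambda>w. \<Delta> k i w) \<in> borel_measurable (pre k)" "square_integrable M (\<lambda>w. \<Delta> k i w)"
    by (rule measurable_\<Delta>[OF i]) (intro square_integrable_iterates i)
  have V: "(\<lambda>w. h k i w - hstar i) \<in> borel_measurable (pre k)" "square_integrable M (\<lambda>w. h k i w - hstar i)"
    using measurable_history_pre[OF measurable_h_history[OF i], of k]
    by simp (intro square_integrable_iterates i)
  note fresh = fresh_seed_pre_quantization[OF i, of k]
  have q: "square_integrable M (\<lambda>w. q k i w)"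
    by (rule fresh_quantization_square_integrable[OF quantization fresh D])
  have "\<alpha> * (\<omega> + 1) \<le> 1" using \<alpha>_le \<omega>_nonneg by (simp add: field_simps)
  then have "\<alpha>\<^sup>2 * (\<omega> + 1) \<le> \<alpha>" using \<alpha>_pos by (simp add: power2_eq_square mult.assoc)
  then have second: "\<alpha>\<^sup>2 * expectation (\<lambda>w. (norm (q k i w))\<^sup>2) \<le> \<alpha> * expectation (\<lambda>w. (norm (\<Delta> k i w))\<^sup>2)"
    using mult_left_mono[OF fresh_quantization_second_moment[OF quantization fresh D], of "\<alpha>\<^sup>2"]
      mult_right_mono[of "\<alpha>\<^sup>2 * (\<omega> + 1)" \<alpha> "expectation (\<lambda>w. (norm (\<Delta> k i w))\<^sup>2)"]
    by (simp add: mult.assoc)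
  have "err_h (Suc k) i = expectation (\<lambda>w. (norm ((h k i w - hstar i) + \<alpha> *\<^sub>R q k i w))\<^sup>2)"
    unfolding err_h_def
    by (intro Bochner_Integration.integral_cong refl) (simp add: h_step[OF i] algebra_simps)
  also have "\<dots> = err_h k i + 2 * \<alpha> * expectation (\<lambda>w. (h k i w - hstar i) \<bullet> \<Delta> k i w)
      + \<alpha>\<^sup>2 * expectation (\<lambda>w. (norm (q k i w))\<^sup>2)"
    using expectation_norm_add_square[OF V(2) square_integrable_scaleR[OF q, of \<alpha>]]
      fresh_quantization_unbiased[OF quantization fresh D V]
    by (simp add: err_h_def power_mult_distrib)
  also have "\<dots> \<le> err_h k i + \<alpha> * (2 * expectation (\<lambda>w. (h k i w - hstar i) \<bullet> \<Delta> k i w)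
      + expectation (\<lambda>w. (norm (\<Delta> k i w))\<^sup>2))"
    using second by (simp add: algebra_simps)
  also have "\<dots> = (1 - \<alpha>) * err_h k i + \<alpha> * expectation (\<lambda>w. (norm (g k i w - hstar i))\<^sup>2)"
    using expectation_norm_add_square[OF V(2) D(2)] by (simp add: err_h_def algebra_simps)
  also have "\<dots> \<le> (1 - \<alpha>) * err_h k i + \<alpha> * (err_grad k i + (\<sigma> i)\<^sup>2)"
    using noise_adds_variance[OF i borel_measurable_const square_integrable_const, of k "hstar i"] \<alpha>_pos
    by (simp add: err_grad_def)
  finally show ?thesis .
qed

text \<open>The memory \<open>h k i\<close> is known before the gradient is sampled, so the noise contributes only its variance;
the rest is \<open>\<parallel>a - b\<parallel>\<^sup>2 \<le> 2 * \<parallel>a\<parallel>\<^sup>2 + 2 * \<parallel>b\<parallel>\<^sup>2\<close> around \<open>grad (f i) xstar\<close>.\<close>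

lemma quantized_difference_bound:
  assumes i: "i \<in> {1..n}"
  shows "expectation (\<lambda>w. (norm (\<Delta> k i w))\<^sup>2) \<le> 2 * err_grad k i + 2 * err_h k i + (\<sigma> i)\<^sup>2"
proof -
  have "(norm (local_grad k i w - h k i w))\<^sup>2 \<le> 2 * (norm (local_grad k i w - hstar i))\<^sup>2 + 2 * (norm (h k i w - hstar i))\<^sup>2" for w
    using zero_le_power2[of "norm ((local_grad k i w - hstar i) + (h k i w - hstar i))"]
    unfolding power2_norm_eq_inner
    by (simp add: inner_add_left inner_add_right inner_diff_left inner_diff_right inner_commute)
  then have "expectation (\<lambda>w. (norm (local_grad k i w - h k i w))\<^sup>2)
      \<le> expectation (\<lambda>w. 2 * (norm (local_grad k i w - hstar i))\<^sup>2 + 2 * (norm (h k i w - hstar i))\<^sup>2)"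
    by (intro integral_mono Bochner_Integration.integrable_add integrable_mult_right
        square_integrable_norm square_integrable_iterates i)
  also have "\<dots> = 2 * err_grad k i + 2 * err_h k i"
    using square_integrable_norm[OF square_integrable_diff[OF square_integrable_grad[OF i] square_integrable_const]]
      square_integrable_norm[OF square_integrable_diff[OF square_integrable_h[OF i] square_integrable_const]]
    by (simp add: err_grad_def err_h_def)
  finally show ?thesis
    using noise_adds_variance[OF i measurable_h_history[OF i] square_integrable_h[OF i], of k]
    by linarith
qed

text \<open>Co-coercivity of each \<open>f i\<close> bounds the cross term of the expanded square from below, and Cauchy-Schwarz
bounds the square of the averaged gradient difference by the average of the squares.\<close>

lemma gradient_step_contraction:
  "(norm (y - xstar - (\<gamma> / real n) *\<^sub>R (\<Sum>i=1..n. grad (f i) y - hstar i)))\<^sup>2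
    \<le> (1 - 2 * \<gamma> * \<mu> * L / (\<mu> + L)) * (norm (y - xstar))\<^sup>2
      + (\<gamma>\<^sup>2 - 2 * \<gamma> / (\<mu> + L)) / real n * (\<Sum>i=1..n. (norm (grad (f i) y - hstar i))\<^sup>2)"
proof -
  define u where "u = (\<lambda>i. grad (f i) y - hstar i)"
  define v where "v = y - xstar"
  define U where "U = (\<Sum>i=1..n. (norm (u i))\<^sup>2)"
  have pos: "0 < real n" "0 < \<mu> + L" using n \<mu>_pos L_pos by auto
  have "(\<Sum>i=1..n. (norm (u i))\<^sup>2 + \<mu> * L * (norm v)\<^sup>2) \<le> (\<Sum>i=1..n. (\<mu> + L) * (u i \<bullet> v))"
    unfolding u_def v_def using strongly_convex smooth
    by (intro sum_mono strongly_convex_smooth_cocoercive) auto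
  then have "U + real n * (\<mu> * L * (norm v)\<^sup>2) \<le> (\<mu> + L) * ((\<Sum>i=1..n. u i) \<bullet> v)"
    by (simp add: U_def sum.distrib inner_sum_left sum_distrib_left)
  then have "2 * (\<gamma> / real n) / (\<mu> + L) * (U + real n * (\<mu> * L * (norm v)\<^sup>2))
      \<le> 2 * (\<gamma> / real n) / (\<mu> + L) * ((\<mu> + L) * ((\<Sum>i=1..n. u i) \<bullet> v))"
    using pos \<gamma>_pos by (intro mult_left_mono) auto
  also have "\<dots> = 2 * (\<gamma> / real n) * ((\<Sum>i=1..n. u i) \<bullet> v)" using pos by simp
  also have "2 * (\<gamma> / real n) / (\<mu> + L) * (U + real n * (\<mu> * L * (norm v)\<^sup>2))
      = 2 * \<gamma> / (\<mu> + L) / real n * U + 2 * \<gamma> * \<mu> * L / (\<mu> + L) * (norm v)\<^sup>2"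
  proof -
    have "2 * (\<gamma> / m) / s * (U + m * (\<mu> * L * N)) = 2 * \<gamma> / s / m * U + 2 * \<gamma> * \<mu> * L / s * N"
      if "m \<noteq> 0" "s \<noteq> 0" for m s N :: real
      using that by (simp add: field_simps)
    then show ?thesis using pos by simp
  qed
  finally have inner: "2 * \<gamma> / (\<mu> + L) / real n * U + 2 * \<gamma> * \<mu> * L / (\<mu> + L) * (norm v)\<^sup>2
      \<le> 2 * (\<gamma> / real n) * ((\<Sum>i=1..n. u i) \<bullet> v)" .
  have "(\<gamma> / real n)\<^sup>2 * (norm (\<Sum>i=1..n. u i))\<^sup>2 \<le> (\<gamma> / real n)\<^sup>2 * (real n * U)"
    using norm_sum_square_le[of "{1..n}" u] by (intro mult_left_mono) (auto simp: U_def)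
  also have "\<dots> = \<gamma>\<^sup>2 / real n * U" using pos by (simp add: power2_eq_square)
  finally have quad: "(\<gamma> / real n)\<^sup>2 * (norm (\<Sum>i=1..n. u i))\<^sup>2 \<le> \<gamma>\<^sup>2 / real n * U" .
  have "(norm (v - (\<gamma> / real n) *\<^sub>R (\<Sum>i=1..n. u i)))\<^sup>2
      = (norm v)\<^sup>2 - 2 * (\<gamma> / real n) * ((\<Sum>i=1..n. u i) \<bullet> v) + (\<gamma> / real n)\<^sup>2 * (norm (\<Sum>i=1..n. u i))\<^sup>2"
    unfolding power2_norm_eq_inner
    by (simp add: inner_diff_left inner_diff_right inner_commute power2_eq_square)
  also have "\<dots> \<le> (norm v)\<^sup>2 - (2 * \<gamma> / (\<mu> + L) / real n * U + 2 * \<gamma> * \<mu> * L / (\<mu> + L) * (norm v)\<^sup>2) + \<gamma>\<^sup>2 / real n * U"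
    using inner quad by linarith
  also have "\<dots> = (1 - 2 * \<gamma> * \<mu> * L / (\<mu> + L)) * (norm v)\<^sup>2 + (\<gamma>\<^sup>2 - 2 * \<gamma> / (\<mu> + L)) / real n * U"
    by (simp add: left_diff_distrib diff_divide_distrib)
  finally show ?thesis by (simp add: u_def v_def U_def)
qed

text \<open>\<open>V\<close> is the exact gradient step, \<open>N\<close> the gradient noise, and the remaining sum in \<open>?E\<close> the quantization
error. \<open>V\<close> is determined by the history and \<open>V + N\<close> is known before quantization, so each
part is orthogonal to the sum of the preceding ones.\<close>

lemma err_x_step:
  "err_x (Suc k) \<le> (1 - 2 * \<gamma> * \<mu> * L / (\<mu> + L)) * err_x k
    + (\<gamma>\<^sup>2 - 2 * \<gamma> / (\<mu> + L)) / real n * (\<Sum>i=1..n. err_grad k i)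
    + \<gamma>\<^sup>2 / real n * (\<Sum>i=1..n. (\<sigma> i)\<^sup>2)
    + (\<gamma> / real n)\<^sup>2 * \<omega> * (\<Sum>i=1..n. 2 * err_grad k i + 2 * err_h k i + (\<sigma> i)\<^sup>2)"
proof -
  define a where "a = - \<gamma> / real n"
  define V where "V = (\<lambda>w. x k w - xstar - (\<gamma> / real n) *\<^sub>R (\<Sum>i=1..n. local_grad k i w - hstar i))"
  define N where "N = (\<lambda>w. \<Sum>i=1..n. a *\<^sub>R (g k i w - local_grad k i w))"
  have V_hist: "V \<in> borel_measurable (hist k)"
    unfolding V_def
    by (intro borel_measurable_diff borel_measurable_scaleR borel_measurable_sum borel_measurable_const
        measurable_x_history measurable_grad_history)
  have V: "square_integrable M V" and N: "square_integrable M N"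
    unfolding V_def N_def
    by (intro square_integrable_iterates square_integrable_scaleR square_integrable_sum; assumption)+
  have N_pre: "N \<in> borel_measurable (pre k)"
    unfolding N_def using measurable_g_pre_quantization measurable_history_pre[OF measurable_grad_history]
    by (intro borel_measurable_sum borel_measurable_scaleR borel_measurable_diff) auto
  have VN: "(\<lambda>w. V w + N w) \<in> borel_measurable (pre k)" "square_integrable M (\<lambda>w. V w + N w)"
    using measurable_history_pre[OF V_hist] N_pre square_integrable_add[OF V N] by auto
  have D: "square_integrable M (\<lambda>w. \<Delta> k i w)" if "i \<in> {1..n}" for i
    by (intro square_integrable_iterates that)
  have q: "square_integrable M (\<lambda>w. q k i w)" if i: "i \<in> {1..n}" for i
    by (rule fresh_quantization_square_integrable[OF quantization fresh_seed_pre_quantization[OF i]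
        measurable_\<Delta>[OF i] D[OF i]])
  let ?E = "\<lambda>w. V w + N w + (\<Sum>i=1..n. a *\<^sub>R (q k i w - \<Delta> k i w))"
  have E: "square_integrable M ?E"
    by (intro square_integrable_add V N square_integrable_sum square_integrable_scaleR square_integrable_diff D q)
  have step: "norm (x (Suc k) w - xstar) \<le> norm (?E w)" if w: "w \<in> space M" for w
  proof -
    have "?E w = x k w - xstar - (\<gamma> / real n) *\<^sub>R ((\<Sum>i=1..n. local_grad k i w - hstar i)
        + (\<Sum>i=1..n. g k i w - local_grad k i w) + (\<Sum>i=1..n. q k i w - \<Delta> k i w))"
    proof -
      have "N w = a *\<^sub>R (\<Sum>i=1..n. g k i w - local_grad k i w)"
        and "(\<Sum>i=1..n. a *\<^sub>R (q k i w - \<Delta> k i w)) = a *\<^sub>R (\<Sum>i=1..n. q k i w - \<Delta> k i w)"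
        unfolding N_def by (rule scaleR_sum_right[symmetric])+
      then show ?thesis by (simp only: V_def) (simp add: a_def scaleR_add_right)
    qed
    also have "(\<Sum>i=1..n. local_grad k i w - hstar i) + (\<Sum>i=1..n. g k i w - local_grad k i w)
        + (\<Sum>i=1..n. q k i w - \<Delta> k i w) = (\<Sum>i=1..n. h k i w + q k i w) - (\<Sum>i=1..n. hstar i)"
      by (simp add: sum.distrib sum_subtractf)
    finally have E_eq: "x k w - \<gamma> *\<^sub>R ((1 / real n) *\<^sub>R (\<Sum>i=1..n. h k i w + q k i w))
        - (xstar - \<gamma> *\<^sub>R ((1 / real n) *\<^sub>R (\<Sum>i=1..n. hstar i))) = ?E w"
      by (simp add: scaleR_diff_right)
    show ?thesis unfolding x_step[OF w] E_eq[symmetric] by (rule prox_step)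
  qed
  have "err_x (Suc k) \<le> expectation (\<lambda>w. (norm (?E w))\<^sup>2)"
    unfolding err_x_def using step
    by (intro integral_mono square_integrable_norm E square_integrable_iterates power_mono) auto
  also have "\<dots> \<le> expectation (\<lambda>w. (norm (V w + N w))\<^sup>2) + a\<^sup>2 * \<omega> * (\<Sum>i=1..n. expectation (\<lambda>w. (norm (\<Delta> k i w))\<^sup>2))"
    by (rule independent_quantization_errors[OF quantization subalgebra_pre_quantization _ seed_measurable
          seed_law fresh_seeds measurable_\<Delta> D VN]) auto
  also have "expectation (\<lambda>w. (norm (V w + N w))\<^sup>2) = expectation (\<lambda>w. (norm (V w))\<^sup>2) + expectation (\<lambda>w. (norm (N w))\<^sup>2)"
  proof -
    have "expectation (\<lambda>w. V w \<bullet> N w) = (\<Sum>i=1..n. expectation (\<lambda>w. a * (V w \<bullet> (g k i w - local_grad k i w))))"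
      unfolding N_def inner_sum_right inner_scaleR_right
      by (intro Bochner_Integration.integral_sum integrable_mult_right square_integrable_inner V square_integrable_noise) auto
    also have "\<dots> = 0" using noise_orthogonal[OF _ V_hist V] by simp
    finally show ?thesis using expectation_norm_add_square[OF V N] by simp
  qed
  also have "expectation (\<lambda>w. (norm (V w))\<^sup>2)
      \<le> (1 - 2 * \<gamma> * \<mu> * L / (\<mu> + L)) * err_x k
        + (\<gamma>\<^sup>2 - 2 * \<gamma> / (\<mu> + L)) / real n * (\<Sum>i=1..n. err_grad k i)"
  proof -
    have int: "integrable M (\<lambda>w. (norm (x k w - xstar))\<^sup>2)"
        "\<And>i. i \<in> {1..n} \<Longrightarrow> integrable M (\<lambda>w. (norm (local_grad k i w - hstar i))\<^sup>2)"
      by (intro square_integrable_norm square_integrable_iterates; assumption)+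
    have "expectation (\<lambda>w. (norm (V w))\<^sup>2) \<le> expectation (\<lambda>w. (1 - 2 * \<gamma> * \<mu> * L / (\<mu> + L)) * (norm (x k w - xstar))\<^sup>2
      + (\<gamma>\<^sup>2 - 2 * \<gamma> / (\<mu> + L)) / real n * (\<Sum>i=1..n. (norm (local_grad k i w - hstar i))\<^sup>2))"
      using gradient_step_contraction
      by (intro integral_mono square_integrable_norm[OF V] Bochner_Integration.integrable_add
          integrable_mult_right Bochner_Integration.integrable_sum int) (simp_all add: V_def)
    also have "\<dots> = (1 - 2 * \<gamma> * \<mu> * L / (\<mu> + L)) * err_x k
        + (\<gamma>\<^sup>2 - 2 * \<gamma> / (\<mu> + L)) / real n * (\<Sum>i=1..n. err_grad k i)"
      unfolding err_x_def err_grad_def by (rule expectation_weighted_sum[OF int])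
    finally show ?thesis .
  qed
  also have "expectation (\<lambda>w. (norm (N w))\<^sup>2) \<le> \<gamma>\<^sup>2 / real n * (\<Sum>i=1..n. (\<sigma> i)\<^sup>2)"
  proof -
    have "(norm (N w))\<^sup>2 \<le> \<gamma>\<^sup>2 / real n * (\<Sum>i=1..n. (norm (g k i w - local_grad k i w))\<^sup>2)" for w
    proof -
      have "(norm (N w))\<^sup>2 \<le> real (card {1..n}) * (\<Sum>i=1..n. (norm (a *\<^sub>R (g k i w - local_grad k i w)))\<^sup>2)"
        unfolding N_def by (rule norm_sum_square_le) simp
      also have "\<dots> = real n * a\<^sup>2 * (\<Sum>i=1..n. (norm (g k i w - local_grad k i w))\<^sup>2)"
        by (simp add: power_mult_distrib sum_distrib_left mult.assoc)
      also have "real n * a\<^sup>2 = \<gamma>\<^sup>2 / real n" using n by (simp add: a_def power2_eq_square)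
      finally show ?thesis .
    qed
    then have "expectation (\<lambda>w. (norm (N w))\<^sup>2)
        \<le> expectation (\<lambda>w. \<gamma>\<^sup>2 / real n * (\<Sum>i=1..n. (norm (g k i w - local_grad k i w))\<^sup>2))"
      by (intro integral_mono square_integrable_norm[OF N] integrable_mult_right
          Bochner_Integration.integrable_sum noise_integrable)
    also have "\<dots> = \<gamma>\<^sup>2 / real n * (\<Sum>i=1..n. expectation (\<lambda>w. (norm (g k i w - local_grad k i w))\<^sup>2))"
      using noise_integrable by (simp del: times_divide_eq_left times_divide_eq_right)
    also have "\<dots> \<le> \<gamma>\<^sup>2 / real n * (\<Sum>i=1..n. (\<sigma> i)\<^sup>2)"
      using noise_bound by (intro mult_left_mono sum_mono) auto
    finally show ?thesis .
  qed
  also have "a\<^sup>2 * \<omega> * (\<Sum>i=1..n. expectation (\<lambda>w. (norm (\<Delta> k i w))\<^sup>2))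
      \<le> (\<gamma> / real n)\<^sup>2 * \<omega> * (\<Sum>i=1..n. 2 * err_grad k i + 2 * err_h k i + (\<sigma> i)\<^sup>2)"
  proof -
    have "a\<^sup>2 = (\<gamma> / real n)\<^sup>2" by (simp add: a_def power_divide)
    then show ?thesis
      by (simp only:) (intro mult_left_mono sum_mono quantized_difference_bound mult_nonneg_nonneg
          \<omega>_nonneg zero_le_power2)
  qed
  finally show ?thesis by simp
qed

lemma expectation_lyapunov:
  "integrable M (\<lambda>w. lyapunov n f c \<gamma> xstar (x k w) (\<lambda>i. h k i w))"
  "expectation (\<lambda>w. lyapunov n f c \<gamma> xstar (x k w) (\<lambda>i. h k i w))
    = err_x k + c * \<gamma>\<^sup>2 / real n * (\<Sum>i=1..n. err_h k i)"
proof -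
  have int: "integrable M (\<lambda>w. (norm (x k w - xstar))\<^sup>2)"
      "\<And>i. i \<in> {1..n} \<Longrightarrow> integrable M (\<lambda>w. (norm (h k i w - hstar i))\<^sup>2)"
    by (intro square_integrable_norm square_integrable_iterates; assumption)+
  show "integrable M (\<lambda>w. lyapunov n f c \<gamma> xstar (x k w) (\<lambda>i. h k i w))"
    unfolding lyapunov_def using int
    by (intro Bochner_Integration.integrable_add integrable_mult_right Bochner_Integration.integrable_sum) auto
  show "expectation (\<lambda>w. lyapunov n f c \<gamma> xstar (x k w) (\<lambda>i. h k i w))
    = err_x k + c * \<gamma>\<^sup>2 / real n * (\<Sum>i=1..n. err_h k i)"
    using expectation_weighted_sum[where a = 1 and b = "c * \<gamma>\<^sup>2 / real n", OF int(1),
        where I = "{1..n}" and Y = "\<lambda>i w. (norm (h k i w - hstar i))\<^sup>2", OF int(2)]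
    unfolding lyapunov_def err_x_def err_h_def by simp
qed

section \<open>Contraction of the Lyapunov function\<close>

text \<open>Adding the recursions for \<open>err_x\<close> and \<open>err_h\<close>, the coefficient of each error is compared separately. The bound on \<open>\<gamma>\<close> by
the smoothness makes the coefficient of the gradient differences nonpositive and limits the noise; \<open>L \<ge> \<mu>\<close>
gives \<open>2 * L / (\<mu> + L) \<ge> 1\<close> for the iterate; for the memory, the condition on \<open>c\<close> gives
\<open>2 * \<omega> / n \<le> c * \<alpha> / 2\<close>, and \<open>\<gamma> * \<mu> \<le> \<alpha> / 2\<close> does the rest.\<close>

lemma lyapunov_step:
  assumes c: "c \<ge> 4 * \<omega> / (\<alpha> * real n)"
    and \<gamma>_smooth: "\<gamma> \<le> 2 / ((\<mu> + L) * (1 + 2 * \<omega> / real n + c * \<alpha>))"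
    and \<gamma>_memory: "\<gamma> \<le> \<alpha> / (2 * \<mu>)"
  shows "err_x (Suc k) + c * \<gamma>\<^sup>2 / real n * (\<Sum>i=1..n. err_h (Suc k) i)
    \<le> (1 - \<gamma> * \<mu>) * (err_x k + c * \<gamma>\<^sup>2 / real n * (\<Sum>i=1..n. err_h k i))
      + \<gamma> * \<mu> * (2 / (\<mu> * (\<mu> + L)) * (1 / real n * (\<Sum>i=1..n. (\<sigma> i)\<^sup>2)))"
proof -
  define m r where "m = real n" and "r = \<omega> / m"
  define \<beta> where "\<beta> = 2 * \<gamma> / (\<mu> + L)"
  define A where "A = 1 - 2 * \<gamma> * \<mu> * L / (\<mu> + L)"
  define Sd Se Ss where "Sd = (\<Sum>i=1..n. err_grad k i)" and "Se = (\<Sum>i=1..n. err_h k i)"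
    and "Ss = (\<Sum>i=1..n. (\<sigma> i)\<^sup>2)"
  have m: "1 \<le> m" and r: "0 \<le> r" using n \<omega>_nonneg by (simp_all add: m_def r_def)
  have \<mu>L_pos: "0 < \<mu> + L" using \<mu>_pos L_pos by simp
  have nonneg: "0 \<le> err_x k" "0 \<le> Sd" "0 \<le> Se" "0 \<le> Ss"
    by (auto simp: err_x_def Sd_def Se_def Ss_def err_grad_def err_h_def intro!: sum_nonneg)
  have c_\<omega>: "4 * r \<le> c * \<alpha>" using c \<alpha>_pos m by (simp add: r_def m_def field_simps)
  then have c_nonneg: "0 \<le> c" using r \<alpha>_pos by (smt (verit) mult_neg_pos)
  have K: "0 < 1 + 2 * r + c * \<alpha>" using r c_nonneg \<alpha>_pos by (simp add: add_pos_nonneg)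
  have \<gamma>_\<beta>: "\<gamma>\<^sup>2 * (1 + 2 * r + c * \<alpha>) \<le> \<beta>"
  proof -
    have "\<gamma> * (1 + 2 * r + c * \<alpha>) \<le> 2 / (\<mu> + L)"
      using \<gamma>_smooth K \<mu>L_pos by (simp add: r_def m_def pos_le_divide_eq mult_ac)
    from mult_left_mono[OF this, of \<gamma>] show ?thesis
      using \<gamma>_pos by (simp add: \<beta>_def power2_eq_square mult_ac)
  qed
  have \<gamma>_\<alpha>: "\<gamma> * \<mu> \<le> \<alpha> / 2" using \<gamma>_memory \<mu>_pos by (simp add: field_simps)
  have A: "A \<le> 1 - \<gamma> * \<mu>"
  proof -
    have "\<gamma> * \<mu> * (\<mu> + L) \<le> \<gamma> * \<mu> * (2 * L)"
      using \<mu>_le_L \<gamma>_pos \<mu>_pos by (intro mult_left_mono) auto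
    then show ?thesis using \<mu>L_pos by (simp add: A_def pos_le_divide_eq mult_ac)
  qed
  have memory: "2 * r + c * (1 - \<alpha>) \<le> c * (1 - \<gamma> * \<mu>)"
    using mult_left_mono[OF \<gamma>_\<alpha> c_nonneg] c_\<omega> by (simp add: algebra_simps)
  have "err_x (Suc k) \<le> A * err_x k + (\<gamma>\<^sup>2 - \<beta>) / m * Sd + \<gamma>\<^sup>2 / m * Ss
      + (\<gamma> / m)\<^sup>2 * \<omega> * (2 * Sd + 2 * Se + Ss)"
    using err_x_step[of k]
    by (simp add: A_def \<beta>_def Sd_def Se_def Ss_def m_def sum.distrib sum_distrib_left)
  also have "(\<gamma> / m)\<^sup>2 * \<omega> = \<gamma>\<^sup>2 / m * r" by (simp add: r_def power2_eq_square)
  finally have x: "err_x (Suc k) \<le> A * err_x k + (\<gamma>\<^sup>2 - \<beta>) / m * Sd + \<gamma>\<^sup>2 / m * Ss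
      + \<gamma>\<^sup>2 / m * r * (2 * Sd + 2 * Se + Ss)" .
  have "(\<Sum>i=1..n. err_h (Suc k) i) \<le> (\<Sum>i=1..n. (1 - \<alpha>) * err_h k i + \<alpha> * (err_grad k i + (\<sigma> i)\<^sup>2))"
    by (intro sum_mono err_h_step)
  also have "\<dots> = (1 - \<alpha>) * Se + \<alpha> * (Sd + Ss)"
    by (simp add: Sd_def Se_def Ss_def sum.distrib sum_distrib_left distrib_left)
  finally have h: "c * \<gamma>\<^sup>2 / m * (\<Sum>i=1..n. err_h (Suc k) i) \<le> c * \<gamma>\<^sup>2 / m * ((1 - \<alpha>) * Se + \<alpha> * (Sd + Ss))"
    using c_nonneg m by (intro mult_left_mono) auto
  have "err_x (Suc k) + c * \<gamma>\<^sup>2 / m * (\<Sum>i=1..n. err_h (Suc k) i)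
      \<le> (A * err_x k + (\<gamma>\<^sup>2 - \<beta>) / m * Sd + \<gamma>\<^sup>2 / m * Ss + \<gamma>\<^sup>2 / m * r * (2 * Sd + 2 * Se + Ss))
        + c * \<gamma>\<^sup>2 / m * ((1 - \<alpha>) * Se + \<alpha> * (Sd + Ss))"
    by (rule add_mono[OF x h])
  also have "\<dots> = A * err_x k + (\<gamma>\<^sup>2 * (1 + 2 * r + c * \<alpha>) - \<beta>) / m * Sd
      + \<gamma>\<^sup>2 / m * Se * (2 * r + c * (1 - \<alpha>)) + \<gamma>\<^sup>2 * (1 + r + c * \<alpha>) * (Ss / m)"
    using m by (simp add: field_simps)
  also have "\<dots> \<le> (1 - \<gamma> * \<mu>) * err_x k + 0 + \<gamma>\<^sup>2 / m * Se * (c * (1 - \<gamma> * \<mu>)) + \<beta> * (Ss / m)"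
  proof (intro add_mono)
    show "A * err_x k \<le> (1 - \<gamma> * \<mu>) * err_x k" using A nonneg by (intro mult_right_mono)
    show "(\<gamma>\<^sup>2 * (1 + 2 * r + c * \<alpha>) - \<beta>) / m * Sd \<le> 0"
      using \<gamma>_\<beta> m nonneg by (intro mult_nonpos_nonneg divide_nonpos_nonneg) auto
    show "\<gamma>\<^sup>2 / m * Se * (2 * r + c * (1 - \<alpha>)) \<le> \<gamma>\<^sup>2 / m * Se * (c * (1 - \<gamma> * \<mu>))"
      using memory m nonneg by (intro mult_left_mono) auto
    have "\<gamma>\<^sup>2 * (1 + r + c * \<alpha>) \<le> \<gamma>\<^sup>2 * (1 + 2 * r + c * \<alpha>)" using r by (intro mult_left_mono) auto
    then show "\<gamma>\<^sup>2 * (1 + r + c * \<alpha>) * (Ss / m) \<le> \<beta> * (Ss / m)"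
      using \<gamma>_\<beta> m nonneg by (intro mult_right_mono) auto
  qed
  also have "\<dots> = (1 - \<gamma> * \<mu>) * (err_x k + c * \<gamma>\<^sup>2 / m * Se) + \<gamma> * \<mu> * (2 / (\<mu> * (\<mu> + L)) * (1 / m * Ss))"
  proof -
    have "\<gamma> * \<mu> * (2 / (\<mu> * (\<mu> + L)) * (1 / m * Ss)) = \<beta> * (Ss / m)"
      using \<mu>_pos by (simp add: \<beta>_def)
    then show ?thesis by (simp add: algebra_simps)
  qed
  finally show ?thesis by (simp add: m_def Se_def Ss_def)
qed

text \<open>The additive constant \<open>B\<close> is the fixed point of the map \<open>y \<mapsto> (1 - \<gamma> * \<mu>) * y + \<gamma> * \<mu> * B\<close> that bounds
one iteration; the distance to it shrinks geometrically.\<close>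

lemma lyapunov_convergence:
  assumes c: "c \<ge> 4 * \<omega> / (\<alpha> * real n)"
    and \<gamma>_smooth: "\<gamma> \<le> 2 / ((\<mu> + L) * (1 + 2 * \<omega> / real n + c * \<alpha>))"
    and \<gamma>_memory: "\<gamma> \<le> \<alpha> / (2 * \<mu>)"
  shows "expectation (\<lambda>w. lyapunov n f c \<gamma> xstar (x k w) (\<lambda>i. h k i w))
    \<le> (1 - \<gamma> * \<mu>) ^ k * lyapunov n f c \<gamma> xstar x\<^sub>0 h\<^sub>0
      + 2 / (\<mu> * (\<mu> + L)) * (1 / real n * (\<Sum>i=1..n. (\<sigma> i)\<^sup>2))"
proof (induction k)
  case 0
  have "expectation (\<lambda>w. lyapunov n f c \<gamma> xstar (x 0 w) (\<lambda>i. h 0 i w))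
      = expectation (\<lambda>_. lyapunov n f c \<gamma> xstar x\<^sub>0 h\<^sub>0)"
    by (intro Bochner_Integration.integral_cong refl) (simp add: lyapunov_def x_init h_init)
  moreover have "0 \<le> 2 / (\<mu> * (\<mu> + L)) * (1 / real n * (\<Sum>i=1..n. (\<sigma> i)\<^sup>2))"
    using \<mu>_pos L_pos by (intro mult_nonneg_nonneg sum_nonneg) auto
  ultimately show ?case by (simp add: prob_space)
next
  case (Suc k)
  define B where "B = 2 / (\<mu> * (\<mu> + L)) * (1 / real n * (\<Sum>i=1..n. (\<sigma> i)\<^sup>2))"
  define \<Psi> where "\<Psi> = (\<lambda>k. expectation (\<lambda>w. lyapunov n f c \<gamma> xstar (x k w) (\<lambda>i. h k i w)))"
  define \<Psi>\<^sub>0 where "\<Psi>\<^sub>0 = lyapunov n f c \<gamma> xstar x\<^sub>0 h\<^sub>0"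
  have "\<alpha> \<le> 1" using \<alpha>_le \<omega>_nonneg by (smt (verit) divide_le_eq_1_pos)
  moreover have "\<gamma> * \<mu> \<le> \<alpha> / 2" using \<gamma>_memory \<mu>_pos by (simp add: field_simps)
  ultimately have contraction: "0 \<le> 1 - \<gamma> * \<mu>" by simp
  have "\<Psi> (Suc k) \<le> (1 - \<gamma> * \<mu>) * \<Psi> k + \<gamma> * \<mu> * B"
    unfolding \<Psi>_def B_def expectation_lyapunov(2) by (rule lyapunov_step[OF assms])
  also have "\<dots> \<le> (1 - \<gamma> * \<mu>) * ((1 - \<gamma> * \<mu>) ^ k * \<Psi>\<^sub>0 + B) + \<gamma> * \<mu> * B"
    using Suc contraction unfolding \<Psi>_def B_def \<Psi>\<^sub>0_def by (intro add_right_mono mult_left_mono)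
  also have "\<dots> = (1 - \<gamma> * \<mu>) ^ Suc k * \<Psi>\<^sub>0 + B" by (simp add: algebra_simps)
  finally show ?case by (simp only: \<Psi>_def B_def \<Psi>\<^sub>0_def)
qed

end

theorem theorem1:
  fixes M :: "'w measure" and S :: "'u measure"
    and Q :: "'u \<Rightarrow> 'a::euclidean_space \<Rightarrow> 'a"
    and n :: nat and f :: "nat \<Rightarrow> 'a \<Rightarrow> real" and R :: "'a \<Rightarrow> ereal"
    and \<mu> L \<omega> \<alpha> \<gamma> c :: real and \<sigma> :: "nat \<Rightarrow> real"
    and xstar x\<^sub>0 :: 'a and h\<^sub>0 :: "nat \<Rightarrow> 'a"
    and x :: "nat \<Rightarrow> 'w \<Rightarrow> 'a" and h g :: "nat \<Rightarrow> nat \<Rightarrow> 'w \<Rightarrow> 'a"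
    and \<xi> :: "nat \<Rightarrow> nat \<Rightarrow> 'w \<Rightarrow> 'u"
  assumes "1 \<le> n"
    and "\<And>i. i \<in> {1..n} \<Longrightarrow> strongly_convex \<mu> (f i)"
    and "\<And>i. i \<in> {1..n} \<Longrightarrow> L_smooth L (f i)"
    and "proper_closed_convex R"
    and "is_arg_min (\<lambda>z. ereal (1 / real n * (\<Sum>i=1..n. f i z)) + R z) (\<lambda>_. True) xstar"
    and "quantization_operator \<omega> S Q"
    and "diana M S Q n f R \<alpha> \<gamma> x\<^sub>0 h\<^sub>0 x h g \<xi>"
    and "\<And>k i. i \<in> {1..n} \<Longrightarrow> integrable M (\<lambda>w. (norm (g k i w - grad (f i) (x k w)))\<^sup>2)"
    and "\<And>k i. i \<in> {1..n} \<Longrightarrow> (LINT w|M. (norm (g k i w - grad (f i) (x k w)))\<^sup>2) \<le> (\<sigma> i)\<^sup>2"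
    and "0 < \<alpha>" and "0 < \<gamma>"
    and "\<alpha> \<le> 1 / (\<omega> + 1)"
    and "c \<ge> 4 * \<omega> / (\<alpha> * real n)"
    and "\<gamma> \<le> 2 / ((\<mu> + L) * (1 + 2 * \<omega> / real n + c * \<alpha>))"
    and "\<gamma> \<le> \<alpha> / (2 * \<mu>)"
  shows "\<forall>k. integrable M (\<lambda>w. lyapunov n f c \<gamma> xstar (x k w) (\<lambda>i. h k i w)) \<and>
     (LINT w|M. lyapunov n f c \<gamma> xstar (x k w) (\<lambda>i. h k i w))
       \<le> (1 - \<gamma> * \<mu>) ^ k * lyapunov n f c \<gamma> xstar x\<^sub>0 h\<^sub>0
         + 2 / (\<mu> * (\<mu> + L)) * (1 / real n * (\<Sum>i=1..n. (\<sigma> i)\<^sup>2))"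
proof (intro allI conjI)
  interpret diana_convergence M S Q n f R \<alpha> \<gamma> x\<^sub>0 h\<^sub>0 x h g \<xi> \<mu> L \<omega> c \<sigma> xstar
    using assms by (intro diana_convergence.intro diana_convergence_axioms.intro)
  fix k
  show "integrable M (\<lambda>w. lyapunov n f c \<gamma> xstar (x k w) (\<lambda>i. h k i w))"
    by (rule expectation_lyapunov(1))
  show "(LINT w|M. lyapunov n f c \<gamma> xstar (x k w) (\<lambda>i. h k i w))
      \<le> (1 - \<gamma> * \<mu>) ^ k * lyapunov n f c \<gamma> xstar x\<^sub>0 h\<^sub>0
        + 2 / (\<mu> * (\<mu> + L)) * (1 / real n * (\<Sum>i=1..n. (\<sigma> i)\<^sup>2))"
    using assms by (intro lyapunov_convergence)
qed

end
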